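(* Let $\mathbf{A}$ be a UHF algebra with a computable presentation $\mathbf{A}^\#$. Then the unique tracial state $\tau_{\mathbf{A}}$ of $\mathbf{A}$ is a computable map from $\mathbf{A}^\#$ to $\mathbb{C}$.
   Context: A UHF algebra is a unital $\mathrm{C}^*$-algebra isomorphic to an inductive limit of full matrix algebras with unital connecting embeddings; it has a unique tracial state. A presentation of a $\mathrm{C}^*$-algebra is a sequence generating a dense $*$-subalgebra; rational points are $*$-polynomials with $\mathbb{Q}(i)$ coefficients and no constant term in it, effectively enumerated; it is computable if an algorithm, given a rational point $q$ and $k$, outputs a rational $r$ with $|\|q\|-r|<2^{-k}$. $\mathbb{C}$ carries its standard presentation with special points $\mathbb{Q}(i)$. A bounded linear map $\phi$ is computable from $\mathbf{A}^\#$ to $\mathbb{C}$ if an algorithm, given a rational point $a$ of $\mathbf{A}^\#$ and $k$, outputs $z\in\mathbb{Q}(i)$ with $|\phi(a)-z|<2^{-k}$. *)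

theory Defs
  imports
    "HOL-Analysis.Analysis"
    "HOL-Library.Nat_Bijection"
    "Jordan_Normal_Form.Matrix"
    "Jordan_Normal_Form.Schur_Decomposition"
begin

subsection \<open>Unital C*-algebras\<close>

text \<open>
  The real vector space structure underlying the library classes is the restriction of the
  complex one (\<open>scaleR_eq_scaleC\<close>). The class \<^class>\<open>real_normed_algebra_1\<close> makes the unit have
  norm one, so the zero algebra (which is not UHF) is excluded.
\<close>

class unital_cstar_algebra = real_normed_algebra_1 + banach +
  fixes scaleC :: "complex \<Rightarrow> 'a \<Rightarrow> 'a"  (infixr \<open>*\<^sub>C\<close> 75)
    and star :: "'a \<Rightarrow> 'a"
  assumes scaleC_add_right: "c *\<^sub>C (x + y) = c *\<^sub>C x + c *\<^sub>C y"
    and scaleC_add_left: "(c + d) *\<^sub>C x = c *\<^sub>C x + d *\<^sub>C x"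
    and scaleC_scaleC: "c *\<^sub>C (d *\<^sub>C x) = (c * d) *\<^sub>C x"
    and scaleR_eq_scaleC: "scaleR r x = complex_of_real r *\<^sub>C x"
    and norm_scaleC: "norm (c *\<^sub>C x) = cmod c * norm x"
    and mult_scaleC_left: "(c *\<^sub>C x) * y = c *\<^sub>C (x * y)"
    and mult_scaleC_right: "x * (c *\<^sub>C y) = c *\<^sub>C (x * y)"
    and star_add: "star (x + y) = star x + star y"
    and star_scaleC: "star (c *\<^sub>C x) = cnj c *\<^sub>C star x"
    and star_mult: "star (x * y) = star y * star x"
    and star_star: "star (star x) = x"
    and cstar_identity: "norm (star x * x) = (norm x)\<^sup>2"

inductive_set generated_star_subalgebra :: "'a::unital_cstar_algebra set \<Rightarrow> 'a set"
  for S :: "'a set" where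
  gen: "x \<in> S \<Longrightarrow> x \<in> generated_star_subalgebra S"
| zero: "0 \<in> generated_star_subalgebra S"
| add: "x \<in> generated_star_subalgebra S \<Longrightarrow> y \<in> generated_star_subalgebra S
    \<Longrightarrow> x + y \<in> generated_star_subalgebra S"
| scale: "x \<in> generated_star_subalgebra S \<Longrightarrow> c *\<^sub>C x \<in> generated_star_subalgebra S"
| mult: "x \<in> generated_star_subalgebra S \<Longrightarrow> y \<in> generated_star_subalgebra S
    \<Longrightarrow> x * y \<in> generated_star_subalgebra S"
| star: "x \<in> generated_star_subalgebra S \<Longrightarrow> star x \<in> generated_star_subalgebra S"


subsection \<open>UHF algebras\<close>

definition unital_matrix_embedding :: "nat \<Rightarrow> nat \<Rightarrow> (complex mat \<Rightarrow> complex mat) \<Rightarrow> bool" where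
  "unital_matrix_embedding k l \<phi> \<longleftrightarrow>
    \<phi> \<in> carrier_mat k k \<rightarrow> carrier_mat l l \<and>
    inj_on \<phi> (carrier_mat k k) \<and>
    \<phi> (1\<^sub>m k) = 1\<^sub>m l \<and>
    (\<forall>x\<in>carrier_mat k k. \<forall>y\<in>carrier_mat k k. \<phi> (x + y) = \<phi> x + \<phi> y) \<and>
    (\<forall>x\<in>carrier_mat k k. \<forall>y\<in>carrier_mat k k. \<phi> (x * y) = \<phi> x * \<phi> y) \<and>
    (\<forall>c. \<forall>x\<in>carrier_mat k k. \<phi> (c \<cdot>\<^sub>m x) = c \<cdot>\<^sub>m \<phi> x) \<and>
    (\<forall>x\<in>carrier_mat k k. \<phi> (mat_adjoint x) = mat_adjoint (\<phi> x))"

definition unital_embedding_of_matrices ::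
    "nat \<Rightarrow> (complex mat \<Rightarrow> 'a::unital_cstar_algebra) \<Rightarrow> bool" where
  "unital_embedding_of_matrices k \<mu> \<longleftrightarrow>
    inj_on \<mu> (carrier_mat k k) \<and>
    \<mu> (1\<^sub>m k) = 1 \<and>
    (\<forall>x\<in>carrier_mat k k. \<forall>y\<in>carrier_mat k k. \<mu> (x + y) = \<mu> x + \<mu> y) \<and>
    (\<forall>x\<in>carrier_mat k k. \<forall>y\<in>carrier_mat k k. \<mu> (x * y) = \<mu> x * \<mu> y) \<and>
    (\<forall>c. \<forall>x\<in>carrier_mat k k. \<mu> (c \<cdot>\<^sub>m x) = c *\<^sub>C \<mu> x) \<and>
    (\<forall>x\<in>carrier_mat k k. \<mu> (mat_adjoint x) = star (\<mu> x))"

text \<open>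
  The algebra is (isomorphic to) the inductive limit of an inductive sequence of matrix algebras
  \<open>M_(k n)\<close> with connecting maps \<open>\<phi> n\<close>, with \<open>\<mu> n\<close> the canonical maps into the limit.
  The \<open>\<mu> n\<close> identify the union of the \<open>M_(k n)\<close> along the \<open>\<phi> n\<close> with a dense *-subalgebra. Injective
  *-homomorphisms of C*-algebras are isometric, so the algebra is the completion of that union in
  the C*-norm of the \<open>M_(k n)\<close>, that is, the limit. No norm on matrices need be mentioned.
\<close>

definition inductive_limit_of_matrix_algebras ::
    "(nat \<Rightarrow> nat) \<Rightarrow> (nat \<Rightarrow> complex mat \<Rightarrow> complex mat)
      \<Rightarrow> (nat \<Rightarrow> complex mat \<Rightarrow> 'a::unital_cstar_algebra) \<Rightarrow> bool" where
  "inductive_limit_of_matrix_algebras k \<phi> \<mu> \<longleftrightarrow>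
    (\<forall>n. k n \<ge> 1) \<and>
    (\<forall>n. unital_matrix_embedding (k n) (k (Suc n)) (\<phi> n)) \<and>
    (\<forall>n. unital_embedding_of_matrices (k n) (\<mu> n)) \<and>
    (\<forall>n. \<forall>x\<in>carrier_mat (k n) (k n). \<mu> (Suc n) (\<phi> n x) = \<mu> n x) \<and>
    closure (\<Union>n. \<mu> n ` carrier_mat (k n) (k n)) = UNIV"

definition uhf_algebra :: "'a::unital_cstar_algebra itself \<Rightarrow> bool" where
  "uhf_algebra A \<longleftrightarrow>
    (\<exists>k \<phi> (\<mu> :: nat \<Rightarrow> complex mat \<Rightarrow> 'a). inductive_limit_of_matrix_algebras k \<phi> \<mu>)"


subsection \<open>Tracial states\<close>

text \<open>
  A state is a positive linear functional of norm one. The order on \<^typ>\<open>complex\<close> is the library's: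
  \<open>0 \<le> z\<close> means that \<open>z\<close> is a nonnegative real.
\<close>

definition state :: "('a::unital_cstar_algebra \<Rightarrow> complex) \<Rightarrow> bool" where
  "state \<tau> \<longleftrightarrow>
    bounded_linear \<tau> \<and> (\<forall>c x. \<tau> (c *\<^sub>C x) = c * \<tau> x) \<and>
    (\<forall>x. 0 \<le> \<tau> (star x * x)) \<and> onorm \<tau> = 1"

definition tracial_state :: "('a::unital_cstar_algebra \<Rightarrow> complex) \<Rightarrow> bool" where
  "tracial_state \<tau> \<longleftrightarrow> state \<tau> \<and> (\<forall>x y. \<tau> (x * y) = \<tau> (y * x))"

definition the_tracial_state :: "'a::unital_cstar_algebra \<Rightarrow> complex" where
  "the_tracial_state = (THE \<tau>. tracial_state \<tau>)"


subsection \<open>Computable functions\<close>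

text \<open>
  \<open>recursive_fun n f\<close>: \<open>f\<close>, restricted to argument lists of length \<open>n\<close>, is a total (general)
  recursive function of arity \<open>n\<close>; minimization is only applied to regular functions. By Kleene's
  normal form theorem these are exactly the total Turing-computable functions.
  The values of \<open>f\<close> on lists of other lengths are irrelevant.
\<close>

inductive recursive_fun :: "nat \<Rightarrow> (nat list \<Rightarrow> nat) \<Rightarrow> bool" where
  zero: "recursive_fun n (\<lambda>xs. 0)"
| succ: "recursive_fun 1 (\<lambda>xs. Suc (hd xs))"
| proj: "i < n \<Longrightarrow> recursive_fun n (\<lambda>xs. xs ! i)"
| comp: "recursive_fun (length gs) f \<Longrightarrow> \<forall>g\<in>set gs. recursive_fun n g
    \<Longrightarrow> recursive_fun n (\<lambda>xs. f (map (\<lambda>g. g xs) gs))"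
| prim_rec: "recursive_fun n f \<Longrightarrow> recursive_fun (n + 2) g
    \<Longrightarrow> recursive_fun (n + 1)
          (\<lambda>xs. rec_nat (f (tl xs)) (\<lambda>m r. g (m # r # tl xs)) (hd xs))"
| minimize: "recursive_fun (n + 1) f \<Longrightarrow> \<forall>xs. length xs = n \<longrightarrow> (\<exists>m. f (m # xs) = 0)
    \<Longrightarrow> recursive_fun n (\<lambda>xs. LEAST m. f (m # xs) = 0)"


subsection \<open>Rational points and computable presentations\<close>

text \<open>Elements of \<open>\<rat>(i)\<close> are represented by their real and imaginary parts.\<close>

type_synonym gaussian_rat = "rat \<times> rat"

definition complex_of_gaussian :: "gaussian_rat \<Rightarrow> complex" where
  "complex_of_gaussian z = Complex (of_rat (fst z)) (of_rat (snd z))"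

text \<open>
  Formal *-polynomials over \<open>\<rat>(i)\<close> in noncommuting indeterminates indexed by \<^typ>\<open>nat\<close>, as
  expressions; the absence of a constructor for constants means that there is no constant term.
\<close>

datatype star_poly =
    Indet nat
  | Scale gaussian_rat star_poly
  | Plus star_poly star_poly
  | Times star_poly star_poly
  | Star star_poly

primrec eval_poly :: "(nat \<Rightarrow> 'a::unital_cstar_algebra) \<Rightarrow> star_poly \<Rightarrow> 'a" where
  "eval_poly a (Indet i) = a i"
| "eval_poly a (Scale c p) = complex_of_gaussian c *\<^sub>C eval_poly a p"
| "eval_poly a (Plus p q) = eval_poly a p + eval_poly a q"
| "eval_poly a (Times p q) = eval_poly a p * eval_poly a q"
| "eval_poly a (Star p) = star (eval_poly a p)"

text \<open>
  Effective enumerations of \<open>\<rat>\<close>, \<open>\<rat>(i)\<close> and of the rational *-polynomials, based on the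
  library's pairing bijection: every number is a code, and every object has a code.
\<close>

definition rat_decode :: "nat \<Rightarrow> rat" where
  "rat_decode n = (case prod_decode n of (p, d) \<Rightarrow> of_int (int_decode p) / of_nat (Suc d))"

definition gaussian_decode :: "nat \<Rightarrow> gaussian_rat" where
  "gaussian_decode n = map_prod rat_decode rat_decode (prod_decode n)"

lemma fst_prod_decode_le: "fst (prod_decode n) \<le> n"
  by (metis le_prod_encode_1 prod.collapse prod_decode_inverse)

lemma snd_prod_decode_le: "snd (prod_decode n) \<le> n"
  by (metis le_prod_encode_2 prod.collapse prod_decode_inverse)

function poly_decode :: "nat \<Rightarrow> star_poly" where
  "poly_decode n =
    (let m = n div 5; x = fst (prod_decode m); y = snd (prod_decode m) in
      if n mod 5 = 0 then Indet m
      else if n mod 5 = 1 then Scale (gaussian_decode x) (poly_decode y)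
      else if n mod 5 = 2 then Plus (poly_decode x) (poly_decode y)
      else if n mod 5 = 3 then Times (poly_decode x) (poly_decode y)
      else Star (poly_decode m))"
  by pat_completeness auto

termination
proof (relation "Wellfounded.measure (\<lambda>n. n)", goal_cases)
  case 1
  then show ?case by simp
next
  case (2 n m x y)
  then show ?case using snd_prod_decode_le[of m] by auto
next
  case (3 n m x y)
  then show ?case using fst_prod_decode_le[of m] by auto
next
  case (4 n m x y)
  then show ?case using snd_prod_decode_le[of m] by auto
next
  case (5 n m x y)
  then show ?case using fst_prod_decode_le[of m] by auto
next
  case (6 n m x y)
  then show ?case using snd_prod_decode_le[of m] by auto
next
  case (7 n m x y)
  then show ?case by auto
qed

declare poly_decode.simps [simp del]

lemma surj_rat_decode: "surj rat_decode"
proof -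
  have "\<exists>n. rat_decode n = q" for q
  proof -
    obtain p d where pd: "quotient_of q = (p, d)" by fastforce
    then have "d > 0" by (rule quotient_of_denom_pos)
    then have "of_nat (Suc (nat d - 1)) = (of_int d :: rat)"
      by (metis Suc_diff_1 of_nat_nat less_imp_le zero_less_nat_eq)
    then have "rat_decode (prod_encode (int_encode p, nat d - 1)) = q"
      using quotient_of_div[OF pd] by (simp add: rat_decode_def del: of_nat_Suc)
    then show ?thesis ..
  qed
  then show ?thesis by (metis surjI)
qed

lemma surj_gaussian_decode: "surj gaussian_decode"
proof -
  have "gaussian_decode = map_prod rat_decode rat_decode \<circ> prod_decode"
    by (auto simp: gaussian_decode_def)
  then show ?thesis
    by (metis comp_surj map_prod_surj surj_prod_decode surj_rat_decode)
qed

lemma poly_decode_code: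
  "poly_decode (5 * m) = Indet m"
  "poly_decode (5 * prod_encode (j, k) + 1) = Scale (gaussian_decode j) (poly_decode k)"
  "poly_decode (5 * prod_encode (j, k) + 2) = Plus (poly_decode j) (poly_decode k)"
  "poly_decode (5 * prod_encode (j, k) + 3) = Times (poly_decode j) (poly_decode k)"
  "poly_decode (5 * m + 4) = Star (poly_decode m)"
proof -
  have qr: "(5 * m + r) div 5 = m" "(5 * m + r) mod 5 = r" if "r < 5" for m r :: nat
    using that by simp_all
  show "poly_decode (5 * m) = Indet m"
    by (subst poly_decode.simps) simp
  show "poly_decode (5 * prod_encode (j, k) + 1) = Scale (gaussian_decode j) (poly_decode k)"
    using qr[of 1 "prod_encode (j, k)"] by (subst poly_decode.simps) (simp only: Let_def, simp)
  show "poly_decode (5 * prod_encode (j, k) + 2) = Plus (poly_decode j) (poly_decode k)"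
    using qr[of 2 "prod_encode (j, k)"] by (subst poly_decode.simps) (simp only: Let_def, simp)
  show "poly_decode (5 * prod_encode (j, k) + 3) = Times (poly_decode j) (poly_decode k)"
    using qr[of 3 "prod_encode (j, k)"] by (subst poly_decode.simps) (simp only: Let_def, simp)
  show "poly_decode (5 * m + 4) = Star (poly_decode m)"
    using qr[of 4 m] by (subst poly_decode.simps) (simp only: Let_def, simp)
qed

lemma surj_poly_decode: "surj poly_decode"
proof -
  have "p \<in> range poly_decode" for p
  proof (induction p)
    case (Indet i)
    show ?case by (metis poly_decode_code(1) rangeI)
  next
    case (Scale c p)
    have "c \<in> range gaussian_decode" using surj_gaussian_decode by simp
    with Scale show ?case by clarify (metis poly_decode_code(2) rangeI)
  next
    case (Plus p q)
    then show ?case by clarify (metis poly_decode_code(3) rangeI)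
  next
    case (Times p q)
    then show ?case by clarify (metis poly_decode_code(4) rangeI)
  next
    case (Star p)
    then show ?case by clarify (metis poly_decode_code(5) rangeI)
  qed
  then show ?thesis by blast
qed

definition rational_point :: "(nat \<Rightarrow> 'a::unital_cstar_algebra) \<Rightarrow> nat \<Rightarrow> 'a" where
  "rational_point a n = eval_poly a (poly_decode n)"

definition presentation :: "(nat \<Rightarrow> 'a::unital_cstar_algebra) \<Rightarrow> bool" where
  "presentation a \<longleftrightarrow> closure (generated_star_subalgebra (range a)) = UNIV"

definition computable_presentation :: "(nat \<Rightarrow> 'a::unital_cstar_algebra) \<Rightarrow> bool" where
  "computable_presentation a \<longleftrightarrow>
    presentation a \<and>
    (\<exists>f. recursive_fun 2 f \<and>
      (\<forall>n k. \<bar>norm (rational_point a n) - of_rat (rat_decode (f [n, k]))\<bar> < (1 / 2) ^ k))"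

text \<open>Computability from the presentation \<open>a\<close> to \<open>\<complex>\<close> with its standard presentation.\<close>

definition computable_functional ::
    "(nat \<Rightarrow> 'a::unital_cstar_algebra) \<Rightarrow> ('a \<Rightarrow> complex) \<Rightarrow> bool" where
  "computable_functional a \<phi> \<longleftrightarrow>
    bounded_linear \<phi> \<and> (\<forall>c x. \<phi> (c *\<^sub>C x) = c * \<phi> x) \<and>
    (\<exists>f. recursive_fun 2 f \<and>
      (\<forall>n k. cmod (\<phi> (rational_point a n) - complex_of_gaussian (gaussian_decode (f [n, k])))
        < (1 / 2) ^ k))"

end

theory Submission
  imports Defs
begin

text \<open>
  In \<open>M\<^sub>k\<close> every matrix is its normalized trace times the identity plus two commutators, with explicit
  factors. Hence the elements \<open>t + [x\<^sub>1, y\<^sub>1] + [x\<^sub>2, y\<^sub>2]\<close> are dense in the algebra, and a trace sends such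
  an element to \<open>t\<close>. This gives uniqueness, consistency of the normalized traces along the limit, and
  an algorithm: given a rational point \<open>q\<close>, search for rational \<open>z, x\<^sub>1, y\<^sub>1, x\<^sub>2, y\<^sub>2\<close> with
  \<open>q + [x\<^sub>1, y\<^sub>1] + [x\<^sub>2, y\<^sub>2] - z\<close> small in norm, and output \<open>z\<close>. As the unit need not be a rational
  point, the norm is tested after multiplication by a fixed rational point \<open>e\<close> with
  \<open>\<parallel>e - 1\<parallel> < 1/2\<close>, which costs at most a factor 2. The normalized trace is bounded by the norm of the
  algebra because it is obtained by averaging over conjugates by unitaries.
\<close>

subsection \<open>Recursive functions\<close>

text \<open>The rules of \<open>recursive_fun\<close> fix a function also on lists of the wrong
  length. Asking only for agreement on lists of length \<open>n\<close> lets closure properties be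
  stated for freely written terms.\<close>

definition computable_on :: "nat \<Rightarrow> (nat list \<Rightarrow> nat) \<Rightarrow> bool" where
  "computable_on n F \<longleftrightarrow> (\<exists>f. recursive_fun n f \<and> (\<forall>xs. length xs = n \<longrightarrow> f xs = F xs))"

lemma recursive_imp_computable_on: "recursive_fun n f \<Longrightarrow> computable_on n f"
  unfolding computable_on_def by blast

lemma computable_on_proj: "i < n \<Longrightarrow> computable_on n (\<lambda>xs. xs ! i)"
  by (intro recursive_imp_computable_on recursive_fun.proj)

lemma computable_on_comp:
  assumes f: "computable_on (length Gs) F" and g: "\<And>G. G \<in> set Gs \<Longrightarrow> computable_on n G"
  shows "computable_on n (\<lambda>xs. F (map (\<lambda>G. G xs) Gs))"
proof -
  obtain f where f: "recursive_fun (length Gs) f" "\<And>xs. length xs = length Gs \<Longrightarrow> f xs = F xs"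
    using f unfolding computable_on_def by blast
  \<comment> \<open>The composition rule takes a list of recursive functions, so a recursive
    representative is chosen for every member of \<open>Gs\<close> at once.\<close>
  define h where "h G = (SOME g. recursive_fun n g \<and> (\<forall>xs. length xs = n \<longrightarrow> g xs = G xs))" for G
  have h: "recursive_fun n (h G) \<and> (\<forall>xs. length xs = n \<longrightarrow> h G xs = G xs)" if "G \<in> set Gs" for G
    using g[OF that] unfolding computable_on_def h_def by (rule someI_ex)
  have "recursive_fun n (\<lambda>xs. f (map (\<lambda>g. g xs) (map h Gs)))"
    by (rule recursive_fun.comp) (use f h in auto)
  moreover have "f (map (\<lambda>g. g xs) (map h Gs)) = F (map (\<lambda>G. G xs) Gs)" if "length xs = n" for xs
  proof -
    have "map (\<lambda>g. g xs) (map h Gs) = map (\<lambda>G. G xs) Gs"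
      using h that by auto
    then show ?thesis using f(2)[of "map (\<lambda>G. G xs) Gs"] by (simp only: length_map)
  qed
  ultimately show ?thesis unfolding computable_on_def by blast
qed

lemma computable_on_comp1:
  "computable_on 1 F \<Longrightarrow> computable_on n G \<Longrightarrow> computable_on n (\<lambda>xs. F [G xs])"
  using computable_on_comp[of "[G]" F n] by simp

lemma computable_on_comp2:
  "computable_on 2 F \<Longrightarrow> computable_on n G \<Longrightarrow> computable_on n H
    \<Longrightarrow> computable_on n (\<lambda>xs. F [G xs, H xs])"
  using computable_on_comp[of "[G, H]" F n] by (auto simp: numeral_2_eq_2)

lemma computable_on_rec:
  assumes "computable_on n F" "computable_on (n + 2) G"
  shows "computable_on (n + 1) (\<lambda>xs. rec_nat (F (tl xs)) (\<lambda>m r. G (m # r # tl xs)) (hd xs))"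
proof -
  obtain f where f: "recursive_fun n f" "\<And>xs. length xs = n \<Longrightarrow> f xs = F xs"
    using assms(1) unfolding computable_on_def by blast
  obtain g where g: "recursive_fun (n + 2) g" "\<And>xs. length xs = n + 2 \<Longrightarrow> g xs = G xs"
    using assms(2) unfolding computable_on_def by blast
  have "rec_nat (f (tl xs)) (\<lambda>m r. g (m # r # tl xs)) (hd xs)
      = rec_nat (F (tl xs)) (\<lambda>m r. G (m # r # tl xs)) (hd xs)" if "length xs = n + 1" for xs
    using that by (simp add: f(2) g(2))
  with recursive_fun.prim_rec[OF f(1) g(1)] show ?thesis
    unfolding computable_on_def by blast
qed

lemma computable_on_Least:
  assumes "computable_on (n + 1) F" "\<And>xs. length xs = n \<Longrightarrow> \<exists>m. F (m # xs) = 0"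
  shows "computable_on n (\<lambda>xs. LEAST m. F (m # xs) = 0)"
proof -
  obtain f where f: "recursive_fun (n + 1) f" "\<And>xs. length xs = n + 1 \<Longrightarrow> f xs = F xs"
    using assms(1) unfolding computable_on_def by blast
  have "recursive_fun n (\<lambda>xs. LEAST m. f (m # xs) = 0)"
    using f assms(2) by (intro recursive_fun.minimize) auto
  moreover have "(LEAST m. f (m # xs) = 0) = (LEAST m. F (m # xs) = 0)" if "length xs = n" for xs
    using that by (simp add: f(2))
  ultimately show ?thesis unfolding computable_on_def by blast
qed

section \<open>Arithmetic on natural numbers\<close>

lemma computable_on_Suc: "computable_on n F \<Longrightarrow> computable_on n (\<lambda>xs. Suc (F xs))"
  using computable_on_comp1[OF recursive_imp_computable_on[OF recursive_fun.succ], of n F] by simp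

lemma computable_on_const: "computable_on n (\<lambda>xs. c)"
  by (induction c) (auto intro: computable_on_Suc recursive_imp_computable_on recursive_fun.zero)

text \<open>The scheme behind the arithmetic below: \<open>X\<close> is the recursion argument,
  \<open>Y\<close> a parameter; the step sees the counter, the previous value and the
  parameter.\<close>

lemma computable_on_binary_rec:
  assumes G: "computable_on 3 (\<lambda>xs. G (xs ! 0) (xs ! 1) (xs ! 2))"
    and F: "computable_on 1 (\<lambda>xs. F (xs ! 0))"
    and xy: "computable_on n X" "computable_on n Y"
  shows "computable_on n (\<lambda>xs. rec_nat (F (Y xs)) (\<lambda>m r. G m r (Y xs)) (X xs))"
proof -
  have "computable_on (1 + 1) (\<lambda>xs. rec_nat (F (tl xs ! 0))
      (\<lambda>m r. G ((m # r # tl xs) ! 0) ((m # r # tl xs) ! 1) ((m # r # tl xs) ! 2)) (hd xs))"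
    using G by (intro computable_on_rec[OF F]) (simp add: numeral_3_eq_3)
  then have "computable_on 2 (\<lambda>xs. rec_nat (F (tl xs ! 0)) (\<lambda>m r. G m r (tl xs ! 0)) (hd xs))"
    by (simp add: numeral_2_eq_2)
  from computable_on_comp2[OF this xy] show ?thesis by simp
qed

lemma computable_on_add:
  assumes "computable_on n X" "computable_on n Y"
  shows "computable_on n (\<lambda>xs. X xs + Y xs)"
proof -
  have "rec_nat y (\<lambda>m r. Suc r) x = x + y" for x y :: nat
    by (induction x) auto
  then show ?thesis
    using computable_on_binary_rec[of "\<lambda>m r y. Suc r" "\<lambda>y. y", OF _ _ assms]
    by (simp add: computable_on_proj computable_on_Suc)
qed

lemma computable_on_mult:
  assumes "computable_on n X" "computable_on n Y"
  shows "computable_on n (\<lambda>xs. X xs * Y xs)"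
proof -
  have "rec_nat 0 (\<lambda>m r. r + y) x = x * y" for x y :: nat
    by (induction x) auto
  then show ?thesis
    using computable_on_binary_rec[of "\<lambda>m r y. r + y" "\<lambda>y. 0", OF _ _ assms]
    by (simp add: computable_on_proj computable_on_add computable_on_const)
qed

lemma computable_on_power2:
  assumes "computable_on n X"
  shows "computable_on n (\<lambda>xs. 2 ^ X xs)"
proof -
  have "rec_nat 1 (\<lambda>m r. r + r) x = (2 :: nat) ^ x" for x :: nat
    by (induction x) auto
  then show ?thesis
    using computable_on_binary_rec[of "\<lambda>m r y. r + r" "\<lambda>y. 1", OF _ _ assms assms]
    by (simp add: computable_on_proj computable_on_add computable_on_const)
qed

lemma computable_on_pred:
  assumes "computable_on n X"
  shows "computable_on n (\<lambda>xs. X xs - 1)"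
proof -
  have "rec_nat 0 (\<lambda>m r. m) x = x - 1" for x :: nat
    by (cases x) auto
  then show ?thesis
    using computable_on_binary_rec[of "\<lambda>m r y. m" "\<lambda>y. 0", OF _ _ assms assms]
    by (simp add: computable_on_proj computable_on_const)
qed

text \<open>Truncated subtraction iterates the predecessor, so the recursion runs on the subtrahend
  and the two arguments change places.\<close>

lemma computable_on_diff:
  assumes "computable_on n X" "computable_on n Y"
  shows "computable_on n (\<lambda>xs. X xs - Y xs)"
proof -
  have "rec_nat x (\<lambda>m r. r - 1) y = x - y" for x y :: nat
    by (induction y) auto
  then show ?thesis
    using computable_on_binary_rec[of "\<lambda>m r y. r - 1" "\<lambda>y. y", OF _ _ assms(2,1)]
    by (simp add: computable_on_proj computable_on_pred[simplified])
qed

lemma computable_on_triangle: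
  assumes "computable_on n X"
  shows "computable_on n (\<lambda>xs. triangle (X xs))"
proof -
  have "rec_nat 0 (\<lambda>m r. r + Suc m) x = triangle x" for x :: nat
    by (induction x) auto
  then show ?thesis
    using computable_on_binary_rec[of "\<lambda>m r y. r + Suc m" "\<lambda>y. 0", OF _ _ assms assms]
    by (simp add: computable_on_proj computable_on_add computable_on_Suc computable_on_const)
qed

section \<open>Pairing and its inverse by search\<close>

lemma computable_on_prod_encode:
  "computable_on n X \<Longrightarrow> computable_on n Y \<Longrightarrow> computable_on n (\<lambda>xs. prod_encode (X xs, Y xs))"
  by (simp add: prod_encode_def computable_on_add computable_on_triangle)

text \<open>The last two hypotheses make \<open>g x\<close> the least zero of \<open>F\<close> in
  its first argument. Inverses of increasing functions thus become computable by minimization,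
  without a recursion of their own.\<close>

lemma computable_on_unary_Least:
  assumes "computable_on 2 (\<lambda>xs. F (xs ! 0) (xs ! 1))" "computable_on n X" "\<And>x. F (g x) x = 0"
    "\<And>m x. F m x = 0 \<Longrightarrow> g x \<le> m"
  shows "computable_on n (\<lambda>xs. g (X xs))"
proof -
  have "(LEAST m. F m x = 0) = g x" for x
    by (rule Least_equality) (use assms(3,4) in auto)
  moreover have "computable_on 1 (\<lambda>xs. LEAST m. F ((m # xs) ! 0) ((m # xs) ! 1) = 0)"
    using assms(1,3) by (intro computable_on_Least) (auto simp: numeral_2_eq_2)
  ultimately have "computable_on 1 (\<lambda>xs. g (xs ! 0))" by simp
  from computable_on_comp1[OF this assms(2)] show ?thesis by simp
qed

lemma computable_on_half:
  assumes "computable_on n X"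
  shows "computable_on n (\<lambda>xs. X xs div 2)"
proof (rule computable_on_unary_Least[OF _ assms])
  \<comment> \<open>\<open>x div 2\<close> is the least \<open>m\<close> with
    \<open>x <= 2 * m + 1\<close>; a truncated difference vanishes exactly when such an inequality
    holds.\<close>
  show "computable_on 2 (\<lambda>xs. xs ! 1 - (2 * xs ! 0 + 1))"
    by (intro computable_on_diff computable_on_add computable_on_mult computable_on_const
        computable_on_proj) auto
qed auto

text \<open>The pairing enumerates the diagonals \<open>p + q = 0, 1, ...\<close> in turn, with code
  \<open>triangle (p + q) + p\<close>. The diagonals up to \<open>m\<close> therefore fill exactly
  the numbers below \<open>triangle (Suc m)\<close>.\<close>

lemma prod_decode_sum_le_iff:
  "fst (prod_decode x) + snd (prod_decode x) \<le> m \<longleftrightarrow> x < triangle (Suc m)"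
proof -
  obtain p q where pq: "prod_decode x = (p, q)" by force
  then have x: "x = triangle (p + q) + p"
    using prod_decode_inverse[of x] by (simp add: prod_encode_def)
  have mono: "triangle i \<le> triangle j" if "i \<le> j" for i j
    using that by (induction rule: dec_induct) auto
  show ?thesis
  proof
    assume "fst (prod_decode x) + snd (prod_decode x) \<le> m"
    then have "triangle (Suc (p + q)) \<le> triangle (Suc m)" using pq by (intro mono) auto
    then show "x < triangle (Suc m)" using x by simp
  next
    assume *: "x < triangle (Suc m)"
    have "p + q \<le> m"
    proof (rule ccontr)
      assume "\<not> p + q \<le> m"
      then have "triangle (Suc m) \<le> triangle (p + q)" by (intro mono) auto
      then show False using * x by simp
    qed
    then show "fst (prod_decode x) + snd (prod_decode x) \<le> m" using pq by simp
  qed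
qed

text \<open>The diagonal is found first, by search; the first component is then the offset within
  it, and the second the remaining difference.\<close>

lemma computable_on_prod_decode_sum:
  assumes "computable_on n X"
  shows "computable_on n (\<lambda>xs. fst (prod_decode (X xs)) + snd (prod_decode (X xs)))"
proof (rule computable_on_unary_Least[OF _ assms])
  show "computable_on 2 (\<lambda>xs. Suc (xs ! 1) - triangle (Suc (xs ! 0)))"
    by (intro computable_on_diff computable_on_triangle computable_on_Suc computable_on_proj) auto
  show "Suc x - triangle (Suc (fst (prod_decode x) + snd (prod_decode x))) = 0" for x
    using prod_decode_sum_le_iff[of x "fst (prod_decode x) + snd (prod_decode x)"] by simp
  show "fst (prod_decode x) + snd (prod_decode x) \<le> m" if "Suc x - triangle (Suc m) = 0" for x m
    using that unfolding prod_decode_sum_le_iff by simp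
qed

lemma computable_on_fst_prod_decode:
  assumes "computable_on n X"
  shows "computable_on n (\<lambda>xs. fst (prod_decode (X xs)))"
proof -
  have "x - triangle (fst (prod_decode x) + snd (prod_decode x)) = fst (prod_decode x)" for x
    using prod_decode_inverse[of x] by (simp add: prod_encode_def case_prod_beta)
  then show ?thesis
    using computable_on_diff[OF assms computable_on_triangle[OF computable_on_prod_decode_sum[OF assms]]]
    by simp
qed

lemma computable_on_snd_prod_decode:
  assumes "computable_on n X"
  shows "computable_on n (\<lambda>xs. snd (prod_decode (X xs)))"
  using computable_on_diff[OF computable_on_prod_decode_sum[OF assms] computable_on_fst_prod_decode[OF assms]]
  by simp

lemmas computable_on_intros = computable_on_proj computable_on_const computable_on_Suc
  computable_on_add computable_on_mult computable_on_diff computable_on_power2 computable_on_half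
  computable_on_prod_encode computable_on_fst_prod_decode computable_on_snd_prod_decode

text \<open>An odd code of the numerator stands for a negative integer, see \<^const>\<open>int_decode\<close>; the first
  factor then vanishes.\<close>

definition below_pow2 :: "nat \<Rightarrow> nat \<Rightarrow> nat" where
  "below_pow2 v j = (1 - (fst (prod_decode v) - 2 * (fst (prod_decode v) div 2))) *
     (Suc (fst (prod_decode v) div 2 * 2 ^ j) - Suc (snd (prod_decode v)))"

text \<open>Clearing the positive denominators leaves an inequality of integers. For a nonnegative
  numerator the two successors turn the strict inequality into the vanishing of a truncated
  difference.\<close>

lemma below_pow2_iff: "below_pow2 v j = 0 \<longleftrightarrow> rat_decode v < (1 / 2) ^ j"
proof -
  obtain p d where pd: "prod_decode v = (p, d)" by force
  have "(rat_decode v < (1 / 2) ^ j) \<longleftrightarrow> (of_int (int_decode p) * 2 ^ j < (of_nat (Suc d) :: rat))"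
    by (simp add: rat_decode_def pd field_simps power_one_over del: of_nat_Suc)
  also have "\<dots> \<longleftrightarrow> int_decode p * 2 ^ j < int (Suc d)"
    by (metis (no_types, opaque_lifting) of_int_less_iff of_int_mult of_int_numeral of_int_of_nat_eq of_int_power)
  also have "\<dots> \<longleftrightarrow> below_pow2 v j = 0"
  proof (cases "even p")
    case True
    then have "int_decode p = int (p div 2)" by (simp add: int_decode_def sum_decode_def)
    then have "int_decode p * 2 ^ j < int (Suc d) \<longleftrightarrow> p div 2 * 2 ^ j < Suc d"
      by (simp only: of_nat_less_iff[where 'a = int, symmetric] of_nat_mult of_nat_power
          of_nat_numeral)
    then show ?thesis using True by (auto simp: below_pow2_def pd)
  next
    case False
    then have "int_decode p < 0" by (simp add: int_decode_def sum_decode_def)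
    then have "int_decode p * 2 ^ j < 0" by (simp add: mult_neg_pos)
    moreover have "p - 2 * (p div 2) = 1" using False by presburger
    ultimately show ?thesis by (simp add: below_pow2_def pd)
  qed
  finally show ?thesis ..
qed

lemma computable_on_below_pow2:
  "computable_on n X \<Longrightarrow> computable_on n Y \<Longrightarrow> computable_on n (\<lambda>xs. below_pow2 (X xs) (Y xs))"
  unfolding below_pow2_def by (intro computable_on_intros)

subsection \<open>The normalized trace of a matrix\<close>

lemma index_mult_mat_sum:
  assumes "A \<in> carrier_mat k k" "B \<in> carrier_mat k k" "i < k" "j < k"
  shows "(A * B) $$ (i, j) = (\<Sum>l<k. A $$ (i, l) * B $$ (l, j))"
  using assms by (auto simp: scalar_prod_def lessThan_atLeast0 intro!: sum.cong)

lemma mat_adjoint_carrier: "A \<in> carrier_mat k k \<Longrightarrow> mat_adjoint A \<in> carrier_mat k k"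
  unfolding mat_adjoint_def by (auto simp: mat_of_rows_def)

lemma index_mat_adjoint:
  fixes A :: "complex mat"
  assumes "A \<in> carrier_mat k k" "i < k" "j < k"
  shows "mat_adjoint A $$ (i, j) = cnj (A $$ (j, i))"
  using assms unfolding mat_adjoint_def by (auto simp: mat_of_rows_def)

definition ntrace :: "nat \<Rightarrow> complex mat \<Rightarrow> complex" where
  "ntrace k A = (\<Sum>i<k. A $$ (i, i)) / of_nat k"

lemma ntrace_one: "k \<ge> 1 \<Longrightarrow> ntrace k (1\<^sub>m k) = 1"
  by (simp add: ntrace_def)

lemma ntrace_add:
  "A \<in> carrier_mat k k \<Longrightarrow> B \<in> carrier_mat k k \<Longrightarrow> ntrace k (A + B) = ntrace k A + ntrace k B"
  by (simp add: ntrace_def sum.distrib add_divide_distrib)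

lemma ntrace_smult: "A \<in> carrier_mat k k \<Longrightarrow> ntrace k (c \<cdot>\<^sub>m A) = c * ntrace k A"
  by (simp add: ntrace_def sum_distrib_left)

lemma ntrace_mult_commute:
  assumes "A \<in> carrier_mat k k" "B \<in> carrier_mat k k"
  shows "ntrace k (A * B) = ntrace k (B * A)"
proof -
  have "(\<Sum>i<k. (A * B) $$ (i, i)) = (\<Sum>i<k. \<Sum>l<k. A $$ (i, l) * B $$ (l, i))"
    using assms by (intro sum.cong refl index_mult_mat_sum) auto
  also have "\<dots> = (\<Sum>l<k. \<Sum>i<k. B $$ (l, i) * A $$ (i, l))"
    by (subst sum.swap) (simp add: mult.commute)
  also have "\<dots> = (\<Sum>l<k. (B * A) $$ (l, l))"
    using assms by (intro sum.cong refl index_mult_mat_sum[symmetric]) auto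
  finally show ?thesis by (simp add: ntrace_def)
qed

text \<open>The diagonal entries of the product are the squared lengths of the columns of
  \<open>A\<close>.\<close>

lemma ntrace_adjoint_mult_nonneg:
  assumes "A \<in> carrier_mat k k"
  shows "0 \<le> ntrace k (mat_adjoint A * A)"
proof -
  have "(mat_adjoint A * A) $$ (i, i) = of_real (\<Sum>l<k. (cmod (A $$ (l, i)))\<^sup>2)" if "i < k" for i
  proof -
    have "(mat_adjoint A * A) $$ (i, i) = (\<Sum>l<k. cnj (A $$ (l, i)) * A $$ (l, i))"
      unfolding index_mult_mat_sum[OF mat_adjoint_carrier[OF assms] assms that that]
      using index_mat_adjoint[OF assms that] by (intro sum.cong) auto
    then show ?thesis by (simp add: complex_norm_square mult.commute del: of_real_power)
  qed
  then have "ntrace k (mat_adjoint A * A)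
      = of_real ((\<Sum>i<k. \<Sum>l<k. (cmod (A $$ (l, i)))\<^sup>2) / real k)"
    by (simp add: ntrace_def)
  moreover have "0 \<le> (\<Sum>i<k. \<Sum>l<k. (cmod (A $$ (l, i)))\<^sup>2) / real k"
    by (intro divide_nonneg_nonneg sum_nonneg) auto
  ultimately show ?thesis by (simp add: less_eq_complex_def del: of_real_divide of_real_sum)
qed

text \<open>Written with the scalar -1 instead of a subtraction, so that the additive,
  multiplicative and scalar laws of an embedding apply directly.\<close>

abbreviation mat_commutator :: "complex mat \<Rightarrow> complex mat \<Rightarrow> complex mat" where
  "mat_commutator A B \<equiv> A * B + (- 1) \<cdot>\<^sub>m (B * A)"

text \<open>Commuting with the diagonal matrix with entries \<open>0, ..., k - 1\<close> multiplies
  the entry \<open>(i, j)\<close> by \<open>i - j\<close>, which is invertible off the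
  diagonal.\<close>

lemma off_diagonal_commutator:
  fixes X :: "complex mat"
  assumes X: "X \<in> carrier_mat k k"
  obtains A B where "A \<in> carrier_mat k k" "B \<in> carrier_mat k k"
    "\<And>i j. i < k \<Longrightarrow> j < k \<Longrightarrow> mat_commutator A B $$ (i, j) = (if i = j then 0 else X $$ (i, j))"
proof
  define A where "A = Matrix.mat k k (\<lambda>(i, j). if i = j then complex_of_nat i else 0)"
  define B where "B = Matrix.mat k k (\<lambda>(i, j). if i = j then 0
      else X $$ (i, j) / (complex_of_nat i - complex_of_nat j))"
  show A: "A \<in> carrier_mat k k" and B: "B \<in> carrier_mat k k" by (auto simp: A_def B_def)
  fix i j assume ij: "i < k" "j < k"
  have "(A * B) $$ (i, j) = (\<Sum>l<k. if l = i then of_nat i * B $$ (i, j) else 0)"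
    unfolding index_mult_mat_sum[OF A B ij] using ij by (intro sum.cong) (auto simp: A_def)
  moreover have "(B * A) $$ (i, j) = (\<Sum>l<k. if l = j then B $$ (i, j) * of_nat j else 0)"
    unfolding index_mult_mat_sum[OF B A ij] using ij by (intro sum.cong) (auto simp: A_def)
  ultimately have "mat_commutator A B $$ (i, j) = (of_nat i - of_nat j) * B $$ (i, j)"
    using A B ij by (simp add: algebra_simps)
  then show "mat_commutator A B $$ (i, j) = (if i = j then 0 else X $$ (i, j))"
    using ij by (simp add: B_def)
qed

text \<open>With \<open>A\<close> the upper shift and \<open>B\<close> carrying the partial sums of
  \<open>d\<close> below the diagonal, \<open>A * B\<close> and \<open>B * A\<close> are diagonal
  with entries \<open>b i\<close> and \<open>b (i - 1)\<close>, whose difference telescopes to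
  \<open>d i\<close>.\<close>

lemma diagonal_commutator:
  fixes d :: "nat \<Rightarrow> complex"
  assumes d: "(\<Sum>i<k. d i) = 0"
  obtains A B where "A \<in> carrier_mat k k" "B \<in> carrier_mat k k"
    "\<And>i j. i < k \<Longrightarrow> j < k \<Longrightarrow> mat_commutator A B $$ (i, j) = (if i = j then d i else 0)"
proof
  define b where "b j = (\<Sum>l\<le>j. d l)" for j
  define A where "A = Matrix.mat k k (\<lambda>(i, j). if j = Suc i then 1 else 0 :: complex)"
  define B where "B = Matrix.mat k k (\<lambda>(i, j). if i = Suc j then b j else 0)"
  show A: "A \<in> carrier_mat k k" and B: "B \<in> carrier_mat k k" by (auto simp: A_def B_def)
  fix i j assume ij: "i < k" "j < k"
  have "(A * B) $$ (i, j) = (\<Sum>l<k. if l = Suc i then (if i = j then b i else 0) else 0)"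
    unfolding index_mult_mat_sum[OF A B ij] using ij
    by (intro sum.cong) (auto simp: A_def B_def)
  also have "\<dots> = (if i = j then b i else 0)"
  proof (cases "Suc i < k")
    case False
    \<comment> \<open>In the last row the shift leaves the matrix and the product entry is 0. This
      agrees with \<open>b i\<close>, which is there the full sum of \<open>d\<close>.\<close>
    with ij have "{..<k} = {..i}" by auto
    then have "b i = 0" using d by (simp add: b_def)
    then show ?thesis by auto
  qed simp
  finally have AB: "(A * B) $$ (i, j) = (if i = j then b i else 0)" .
  have "(B * A) $$ (i, j) = (\<Sum>l<k. if Suc l = i then (if i = j then b l else 0) else 0)"
    unfolding index_mult_mat_sum[OF B A ij] using ij
    by (intro sum.cong) (auto simp: A_def B_def)
  also have "\<dots> = (if i = j then b i - d i else 0)"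
  proof (cases i)
    \<comment> \<open>In the first row \<open>B\<close> vanishes, and
      \<open>b 0 = d 0\<close>.\<close>
    case 0
    then show ?thesis by (simp add: b_def)
  next
    case (Suc m)
    then show ?thesis using ij by (auto simp: b_def)
  qed
  finally show "mat_commutator A B $$ (i, j) = (if i = j then d i else 0)"
    using A B ij AB by simp
qed

text \<open>The first commutator supplies the off-diagonal part. The diagonal minus its mean has sum
  zero, so the second supplies that.\<close>

lemma matrix_sum_of_two_commutators:
  assumes k: "k \<ge> 1" and X: "X \<in> carrier_mat k k"
  obtains A B C D where "A \<in> carrier_mat k k" "B \<in> carrier_mat k k"
    "C \<in> carrier_mat k k" "D \<in> carrier_mat k k"
    "X = ntrace k X \<cdot>\<^sub>m 1\<^sub>m k + (mat_commutator A B + mat_commutator C D)"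
proof -
  obtain A B where AB: "A \<in> carrier_mat k k" "B \<in> carrier_mat k k"
    "\<And>i j. i < k \<Longrightarrow> j < k \<Longrightarrow> mat_commutator A B $$ (i, j) = (if i = j then 0 else X $$ (i, j))"
    using off_diagonal_commutator[OF X] by blast
  have "(\<Sum>i<k. X $$ (i, i) - ntrace k X) = 0"
    using k by (simp add: sum_subtractf ntrace_def)
  from diagonal_commutator[OF this] obtain C D where CD: "C \<in> carrier_mat k k" "D \<in> carrier_mat k k"
    "\<And>i j. i < k \<Longrightarrow> j < k \<Longrightarrow>
      mat_commutator C D $$ (i, j) = (if i = j then X $$ (i, i) - ntrace k X else 0)"
    by blast
  have "X = ntrace k X \<cdot>\<^sub>m 1\<^sub>m k + (mat_commutator A B + mat_commutator C D)"
  proof (rule eq_matI)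
    fix i j
    assume "i < dim_row (ntrace k X \<cdot>\<^sub>m 1\<^sub>m k + (mat_commutator A B + mat_commutator C D))"
      "j < dim_col (ntrace k X \<cdot>\<^sub>m 1\<^sub>m k + (mat_commutator A B + mat_commutator C D))"
    then have ij: "i < k" "j < k" using CD by auto
    have "(mat_commutator A B + mat_commutator C D) $$ (i, j)
        = mat_commutator A B $$ (i, j) + mat_commutator C D $$ (i, j)"
      using AB CD ij by (intro index_add_mat) auto
    then have "(ntrace k X \<cdot>\<^sub>m 1\<^sub>m k + (mat_commutator A B + mat_commutator C D)) $$ (i, j)
        = (if i = j then ntrace k X else 0)
          + (mat_commutator A B $$ (i, j) + mat_commutator C D $$ (i, j))"
      using AB(1,2) CD(1,2) ij by simp
    then show "X $$ (i, j) =
        (ntrace k X \<cdot>\<^sub>m 1\<^sub>m k + (mat_commutator A B + mat_commutator C D)) $$ (i, j)"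
      unfolding AB(3)[OF ij] CD(3)[OF ij] by simp
  qed (use X CD in auto)
  with AB CD that show ?thesis by blast
qed

text \<open>The products of a power of the clock matrix and a power of the cyclic shift.\<close>

definition weyl_mat :: "nat \<Rightarrow> nat \<times> nat \<Rightarrow> complex mat" where
  "weyl_mat k u = Matrix.mat k k (\<lambda>(a, b).
     if b = (a + snd u) mod k then cis (2 * pi * real a / real k) ^ fst u else 0)"

lemma weyl_mat_carrier [simp]: "weyl_mat k u \<in> carrier_mat k k"
  by (simp add: weyl_mat_def)

text \<open>Serves both for the unitarity of the shift and for reindexing the diagonal sum by a
  cyclic translation.\<close>

lemma inj_on_add_mod: "inj_on (\<lambda>a. (a + q) mod k) {..<k :: nat}"
proof (rule inj_onI)
  have *: "a = b" if "a \<le> b" "b < k" "(a + q) mod k = (b + q) mod k" for a b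
  proof -
    have "k dvd (b + q) - (a + q)" using that mod_eq_dvd_iff_nat[of "a + q" "b + q" k] by simp
    then show ?thesis using that dvd_imp_le[of k "b - a"] by (cases "a = b") auto
  qed
  fix a b assume "a \<in> {..<k}" "b \<in> {..<k}" "(a + q) mod k = (b + q) mod k"
  then show "a = b" using *[of a b] *[of b a] by (cases "a \<le> b") auto
qed

lemma index_weyl_mat:
  "a < k \<Longrightarrow> b < k \<Longrightarrow> weyl_mat k u $$ (a, b) =
    (if b = (a + snd u) mod k then cis (2 * pi * real a / real k) ^ fst u else 0)"
  by (simp add: weyl_mat_def)

text \<open>Each row has a single nonzero entry, of modulus one, and distinct rows have it in
  distinct columns.\<close>

lemma weyl_mat_unitary: "weyl_mat k u * mat_adjoint (weyl_mat k u) = 1\<^sub>m k"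
proof (rule eq_matI)
  fix a b assume "a < dim_row (1\<^sub>m k :: complex mat)" "b < dim_col (1\<^sub>m k :: complex mat)"
  then have ab: "a < k" "b < k" by auto
  let ?w = "\<lambda>a. cis (2 * pi * real a / real k) ^ fst u"
  have "(weyl_mat k u * mat_adjoint (weyl_mat k u)) $$ (a, b)
      = (\<Sum>c<k. weyl_mat k u $$ (a, c) * cnj (weyl_mat k u $$ (b, c)))"
    using ab index_mult_mat_sum[OF weyl_mat_carrier mat_adjoint_carrier[OF weyl_mat_carrier] ab]
    by (auto simp: index_mat_adjoint[OF weyl_mat_carrier] intro!: sum.cong)
  also have "\<dots> = (\<Sum>c<k. if c = (a + snd u) mod k then if a = b then 1 else 0 else 0)"
  proof (intro sum.cong refl)
    fix c assume c: "c \<in> {..<k}"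
    have "cmod (?w a) = 1" by (simp add: norm_power)
    then have "?w a * cnj (?w a) = 1" by (simp only: complex_norm_square[symmetric]) simp
    then show "weyl_mat k u $$ (a, c) * cnj (weyl_mat k u $$ (b, c))
        = (if c = (a + snd u) mod k then if a = b then 1 else 0 else 0)"
      using ab c inj_onD[OF inj_on_add_mod, of a "snd u" k b] by (auto simp: weyl_mat_def)
  qed
  also have "\<dots> = (1\<^sub>m k) $$ (a, b)" using ab by simp
  finally show "(weyl_mat k u * mat_adjoint (weyl_mat k u)) $$ (a, b) = (1\<^sub>m k) $$ (a, b)" .
qed (auto simp: mat_adjoint_def mat_of_rows_def weyl_mat_def)

text \<open>The shift translates both indices by \<open>q\<close>; the clock contributes the
  \<open>p\<close>-th power of the quotient of two roots of unity, written with a conjugate. Both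
  sums collapse to one term.\<close>

lemma index_weyl_conjugate:
  assumes X: "X \<in> carrier_mat k k" and ab: "a < k" "b < k"
  shows "(weyl_mat k (p, q) * X * mat_adjoint (weyl_mat k (p, q))) $$ (a, b) =
    (cis (2 * pi * real a / real k) * cnj (cis (2 * pi * real b / real k))) ^ p
      * X $$ ((a + q) mod k, (b + q) mod k)"
proof -
  let ?W = "weyl_mat k (p, q)"
  let ?w = "\<lambda>a. cis (2 * pi * real a / real k) ^ p"
  have WX: "(?W * X) $$ (a, d) = ?w a * X $$ ((a + q) mod k, d)" if "d < k" for d
  proof -
    have "(?W * X) $$ (a, d)
        = (\<Sum>c<k. if c = (a + q) mod k then ?w a * X $$ ((a + q) mod k, d) else 0)"
      unfolding index_mult_mat_sum[OF weyl_mat_carrier X ab(1) that]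
      using ab by (intro sum.cong) (auto simp: index_weyl_mat)
    then show ?thesis using ab by simp
  qed
  have c: "?W * X \<in> carrier_mat k k" by (rule mult_carrier_mat[OF weyl_mat_carrier X])
  have "(?W * X * mat_adjoint ?W) $$ (a, b)
      = (\<Sum>d<k. if d = (b + q) mod k
           then ?w a * cnj (?w b) * X $$ ((a + q) mod k, (b + q) mod k) else 0)"
    unfolding index_mult_mat_sum[OF c mat_adjoint_carrier[OF weyl_mat_carrier] ab]
    using ab WX
    by (intro sum.cong) (auto simp: index_mat_adjoint[OF weyl_mat_carrier] index_weyl_mat)
  then show ?thesis using ab by (simp add: power_mult_distrib)
qed

text \<open>Orthogonality of characters: a geometric sum over a \<open>k\<close>-th root of unity,
  which equals 1 only if \<open>a = b\<close> because the listed roots are distinct.\<close>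

lemma sum_roots_of_unity_power:
  assumes "a < k" "b < k"
  shows "(\<Sum>p<k. (cis (2 * pi * real a / real k) * cnj (cis (2 * pi * real b / real k))) ^ p)
    = (if a = b then of_nat k else 0)"
proof -
  let ?w = "\<lambda>a. cis (2 * pi * real a / real k)"
  have k: "k > 0" using assms by simp
  have unit: "?w b * cnj (?w b) = 1" for b by (simp add: complex_norm_square[symmetric])
  have bij: "bij_betw ?w {..<k} {z. z ^ k = 1}" using Complex.bij_betw_roots_unity[OF k] .
  show ?thesis
  proof (cases "a = b")
    case True
    then show ?thesis by (simp only: unit) simp
  next
    case False
    then have "?w a \<noteq> ?w b" using bij assms unfolding bij_betw_def inj_on_def by blast
    moreover have "?w a * cnj (?w b) * ?w b = ?w a"
      using unit[of b] by (simp add: mult.assoc mult.commute del: cis_cnj)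
    ultimately have "?w a * cnj (?w b) \<noteq> 1" by (metis mult_1_left)
    moreover have "?w a ^ k = 1" "?w b ^ k = 1" using bij assms unfolding bij_betw_def by auto
    then have "(?w a * cnj (?w b)) ^ k = 1"
      by (simp add: power_mult_distrib del: cis_cnj flip: complex_cnj_power)
    ultimately show ?thesis using False unfolding sum_gp_strict by simp
  qed
qed

text \<open>The sum over clock powers kills the off-diagonal entries and gives a factor
  \<open>k\<close> on the diagonal; the sum over shifts runs through all diagonal entries, giving
  \<open>k\<close> times the normalized trace. The sum is entrywise because matrices of all sizes
  share one type and have no common zero.\<close>

lemma sum_weyl_conjugates:
  assumes k: "k \<ge> 1" and X: "X \<in> carrier_mat k k"
  shows "Matrix.mat k k (\<lambda>ij. \<Sum>u\<in>{..<k} \<times> {..<k}.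
      (weyl_mat k u * X * mat_adjoint (weyl_mat k u)) $$ ij)
    = ((of_nat k)\<^sup>2 * ntrace k X) \<cdot>\<^sub>m 1\<^sub>m k" (is "?L = ?R")
proof (rule eq_matI)
  fix a b assume "a < dim_row ?R" "b < dim_col ?R"
  then have ab: "a < k" "b < k" by auto
  let ?w = "\<lambda>a. cis (2 * pi * real a / real k)"
  have "?L $$ (a, b) = (\<Sum>p<k. \<Sum>q<k. (?w a * cnj (?w b)) ^ p * X $$ ((a + q) mod k, (b + q) mod k))"
    unfolding sum.cartesian_product using ab
    by (auto simp: index_weyl_conjugate[OF X] intro!: sum.cong)
  also have "\<dots> = (\<Sum>p<k. (?w a * cnj (?w b)) ^ p) * (\<Sum>q<k. X $$ ((a + q) mod k, (b + q) mod k))"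
    by (simp only: sum_product)
  also have "\<dots> = (if a = b then of_nat k * (\<Sum>q<k. X $$ ((a + q) mod k, (a + q) mod k)) else 0)"
    unfolding sum_roots_of_unity_power[OF ab] by simp
  also have "(\<Sum>q<k. X $$ ((a + q) mod k, (a + q) mod k)) = (\<Sum>i<k. X $$ (i, i))"
  proof (rule sum.reindex_bij_betw)
    have "inj_on (\<lambda>q. (a + q) mod k) {..<k}" using inj_on_add_mod[of a k] by (simp add: add.commute)
    moreover from this have "(\<lambda>q. (a + q) mod k) ` {..<k} = {..<k}"
      using k by (intro endo_inj_surj) auto
    ultimately show "bij_betw (\<lambda>q. (a + q) mod k) {..<k} {..<k}" by (simp add: bij_betw_def)
  qed
  also have "(if a = b then of_nat k * (\<Sum>i<k. X $$ (i, i)) else 0) = ?R $$ (a, b)"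
    using ab k by (simp add: ntrace_def power2_eq_square)
  finally show "?L $$ (a, b) = ?R $$ (a, b)" .
qed auto

subsection \<open>Elementary properties of C*-algebras\<close>

lemma scaleC_one [simp]: "1 *\<^sub>C x = (x :: 'a::unital_cstar_algebra)"
  using scaleR_eq_scaleC[of 1 x] by simp

lemma scaleC_minus_one [simp]: "(- 1) *\<^sub>C x = - (x :: 'a::unital_cstar_algebra)"
  using scaleR_eq_scaleC[of "-1" x] by simp

lemma bounded_bilinear_scaleC:
  "bounded_bilinear (scaleC :: complex \<Rightarrow> 'a \<Rightarrow> 'a::unital_cstar_algebra)"
proof
  show "\<exists>K. \<forall>c (x :: 'a). norm (c *\<^sub>C x) \<le> norm c * norm x * K"
    by (rule exI[of _ 1]) (simp add: norm_scaleC)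
  show "(r *\<^sub>R c) *\<^sub>C x = r *\<^sub>R (c *\<^sub>C x)" for r c and x :: 'a
    by (simp add: scaleR_eq_scaleC scaleC_scaleC scaleR_conv_of_real)
  show "c *\<^sub>C (r *\<^sub>R x) = r *\<^sub>R (c *\<^sub>C x)" for r c and x :: 'a
    by (simp add: scaleR_eq_scaleC scaleC_scaleC mult.commute)
qed (simp_all add: scaleC_add_left scaleC_add_right)

lemmas tendsto_scaleC = bounded_bilinear.tendsto[OF bounded_bilinear_scaleC]

text \<open>The C*-identity and submultiplicativity bound the square of \<open>norm y\<close> by
  \<open>norm (star y) * norm y\<close>. Cancel, then apply this to \<open>x\<close> and to
  \<open>star x\<close>.\<close>

lemma norm_star [simp]: "norm (star x) = norm (x :: 'a::unital_cstar_algebra)"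
proof -
  have le: "norm y \<le> norm (star y)" for y :: 'a
  proof (cases "y = 0")
    case False
    have "norm y * norm y \<le> norm (star y) * norm y"
      using norm_mult_ineq[of "star y" y] by (simp add: cstar_identity power2_eq_square)
    then show ?thesis using False by simp
  qed simp
  show ?thesis using le[of x] le[of "star x"] by (simp add: star_star)
qed

lemma bounded_linear_star: "bounded_linear (star :: 'a \<Rightarrow> 'a::unital_cstar_algebra)"
  by (rule bounded_linear_intro[of _ 1]) (auto simp: star_add scaleR_eq_scaleC star_scaleC)

lemmas tendsto_star = bounded_linear.tendsto[OF bounded_linear_star]

lemma norm_unitary:
  assumes "x * star x = (1 :: 'a::unital_cstar_algebra)"
  shows "norm x = 1"
proof -
  have "(norm (star x))\<^sup>2 = 1" using cstar_identity[of "star x"] assms by (simp add: star_star)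
  then have "(norm x)\<^sup>2 = 1\<^sup>2" by simp
  then show ?thesis by (rule power2_eq_imp_eq) auto
qed

subsection \<open>Matrix subalgebras\<close>

locale matrix_subalgebra =
  fixes k :: nat and \<mu> :: "complex mat \<Rightarrow> 'a::unital_cstar_algebra"
  assumes dim: "k \<ge> 1" and embedding: "unital_embedding_of_matrices k \<mu>"
begin

abbreviation "M \<equiv> (carrier_mat k k :: complex mat set)"

lemma hom_one: "\<mu> (1\<^sub>m k) = 1"
  and hom_add: "x \<in> M \<Longrightarrow> y \<in> M \<Longrightarrow> \<mu> (x + y) = \<mu> x + \<mu> y"
  and hom_mult: "x \<in> M \<Longrightarrow> y \<in> M \<Longrightarrow> \<mu> (x * y) = \<mu> x * \<mu> y"
  and hom_scale: "x \<in> M \<Longrightarrow> \<mu> (c \<cdot>\<^sub>m x) = c *\<^sub>C \<mu> x"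
  and hom_star: "x \<in> M \<Longrightarrow> \<mu> (mat_adjoint x) = star (\<mu> x)"
  and hom_inj: "x \<in> M \<Longrightarrow> y \<in> M \<Longrightarrow> \<mu> x = \<mu> y \<Longrightarrow> x = y"
  using embedding unfolding unital_embedding_of_matrices_def inj_on_def by auto

lemma hom_sum:
  assumes "finite I" "\<And>u. u \<in> I \<Longrightarrow> f u \<in> M"
  shows "\<mu> (Matrix.mat k k (\<lambda>ij. \<Sum>u\<in>I. f u $$ ij)) = (\<Sum>u\<in>I. \<mu> (f u))"
  using assms
proof (induction I)
  case empty
  \<comment> \<open>The laws of the embedding do not mention zero, so the zero matrix is treated as
    a scalar multiple of the identity.\<close>
  have "Matrix.mat k k (\<lambda>ij. 0) = 0 \<cdot>\<^sub>m (1\<^sub>m k :: complex mat)" by (rule eq_matI) auto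
  then show ?case
    using hom_scale[of "1\<^sub>m k" 0] bounded_bilinear.zero_left[OF bounded_bilinear_scaleC] by simp
next
  case (insert u I)
  have "Matrix.mat k k (\<lambda>ij. \<Sum>v\<in>insert u I. f v $$ ij)
      = f u + Matrix.mat k k (\<lambda>ij. \<Sum>v\<in>I. f v $$ ij)"
    using insert by (intro eq_matI) auto
  then show ?case using insert by (simp add: hom_add)
qed

lemma hom_commutator:
  "x \<in> M \<Longrightarrow> y \<in> M \<Longrightarrow> \<mu> (mat_commutator x y) = \<mu> x * \<mu> y - \<mu> y * \<mu> x"
  by (simp add: hom_add hom_mult hom_scale mult_carrier_mat[of _ k k _ k])

lemma hom_sum_of_two_commutators:
  assumes X: "X \<in> M"
  obtains A B C D where "A \<in> M" "B \<in> M" "C \<in> M" "D \<in> M"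
    "\<mu> X = ntrace k X *\<^sub>C 1 + ((\<mu> A * \<mu> B - \<mu> B * \<mu> A) + (\<mu> C * \<mu> D - \<mu> D * \<mu> C))"
proof -
  obtain A B C D where M: "A \<in> M" "B \<in> M" "C \<in> M" "D \<in> M"
    and eq: "X = ntrace k X \<cdot>\<^sub>m 1\<^sub>m k + (mat_commutator A B + mat_commutator C D)"
    using matrix_sum_of_two_commutators[OF dim X] by blast
  have c: "mat_commutator A B \<in> M" "mat_commutator C D \<in> M"
    using M by (simp_all add: mult_carrier_mat[of _ k k _ k])
  have "\<mu> X = ntrace k X *\<^sub>C \<mu> (1\<^sub>m k) + (\<mu> (mat_commutator A B) + \<mu> (mat_commutator C D))"
    by (subst eq) (use c in \<open>simp add: hom_add hom_scale\<close>)
  with M that show ?thesis by (simp add: hom_commutator hom_one)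
qed

text \<open>Averaging the conjugates of \<open>X\<close> by the Weyl unitaries gives the scalar matrix with
  entry \<open>ntrace k X\<close>, and averages of unitary conjugates do not increase the norm.\<close>

lemma ntrace_le_norm:
  assumes X: "X \<in> M"
  shows "cmod (ntrace k X) \<le> norm (\<mu> X)"
proof -
  let ?I = "{..<k} \<times> {..<k}"
  have W: "mat_adjoint (weyl_mat k u) \<in> M" for u
    by (rule mat_adjoint_carrier) simp
  have conj: "weyl_mat k u * X * mat_adjoint (weyl_mat k u) \<in> M" for u
    using X W by (intro mult_carrier_mat[of _ k k _ k]) auto
  have norm: "norm (\<mu> (weyl_mat k u * X * mat_adjoint (weyl_mat k u))) \<le> norm (\<mu> X)" for u
  proof -
    let ?w = "\<mu> (weyl_mat k u)"
    have "?w * star ?w = 1"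
      using hom_mult[OF weyl_mat_carrier W, of u u] by (simp add: weyl_mat_unitary hom_one hom_star)
    then have w: "norm ?w = 1" by (rule norm_unitary)
    have "\<mu> (weyl_mat k u * X * mat_adjoint (weyl_mat k u)) = ?w * \<mu> X * star ?w"
      using X W by (simp add: hom_mult hom_star mult_carrier_mat[of _ k k _ k])
    also have "norm \<dots> \<le> norm ?w * norm (\<mu> X) * norm (star ?w)"
      by (meson mult_right_mono norm_ge_zero norm_mult_ineq order_trans)
    finally show ?thesis by (simp add: w)
  qed
  have "((of_nat k)\<^sup>2 * ntrace k X) *\<^sub>C 1
      = (\<Sum>u\<in>?I. \<mu> (weyl_mat k u * X * mat_adjoint (weyl_mat k u)))"
    using arg_cong[OF sum_weyl_conjugates[OF dim X], of \<mu>] conj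
    by (simp add: hom_sum hom_scale hom_one)
  then have "norm (((of_nat k)\<^sup>2 * ntrace k X) *\<^sub>C (1 :: 'a)) \<le> (\<Sum>u\<in>?I. norm (\<mu> X))"
    by (metis (no_types, lifting) norm sum_norm_le)
  then have "(real k)\<^sup>2 * cmod (ntrace k X) \<le> (real k)\<^sup>2 * norm (\<mu> X)"
    by (simp add: norm_scaleC norm_mult norm_power power2_eq_square)
  then show ?thesis using dim by simp
qed

end

subsection \<open>The tracial state\<close>

lemma nonneg_complex_lim:
  fixes f :: "nat \<Rightarrow> complex"
  assumes "f \<longlonglongrightarrow> z" "\<And>n. 0 \<le> f n"
  shows "0 \<le> z"
proof -
  have "0 \<le> Re z" using tendsto_Re[OF assms(1)] assms(2)
    by (intro LIMSEQ_le_const) (auto simp: less_eq_complex_def)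
  moreover have "(\<lambda>n. Im (f n)) = (\<lambda>n. 0)" using assms(2) by (auto simp: less_eq_complex_def)
  then have "Im z = 0" using tendsto_Im[OF assms(1)] LIMSEQ_unique[OF tendsto_const] by metis
  ultimately show ?thesis by (simp add: less_eq_complex_def)
qed

text \<open>A contractive additive functional is uniformly continuous and extends to the closure of
  \<open>D\<close>; each identity or inequality then passes to limits of sequences from
  \<open>D\<close>.\<close>

lemma tracial_state_extension:
  fixes D :: "'a::unital_cstar_algebra set" and f :: "'a \<Rightarrow> complex"
  assumes dense: "closure D = UNIV"
    and add: "\<And>x y. x \<in> D \<Longrightarrow> y \<in> D \<Longrightarrow> x + y \<in> D \<and> f (x + y) = f x + f y"
    and mult: "\<And>x y. x \<in> D \<Longrightarrow> y \<in> D \<Longrightarrow> x * y \<in> D \<and> f (x * y) = f (y * x)"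
    and scale: "\<And>c x. x \<in> D \<Longrightarrow> c *\<^sub>C x \<in> D \<and> f (c *\<^sub>C x) = c * f x"
    and star: "\<And>x. x \<in> D \<Longrightarrow> star x \<in> D \<and> 0 \<le> f (star x * x)"
    and bound: "\<And>x. x \<in> D \<Longrightarrow> cmod (f x) \<le> norm x"
    and one: "1 \<in> D" "f 1 = 1"
  obtains \<tau> where "tracial_state \<tau>" "\<And>x. x \<in> D \<Longrightarrow> \<tau> x = f x" "\<And>x. cmod (\<tau> x) \<le> norm x"
proof -
  have diff: "x - y \<in> D \<and> f (x - y) = f x - f y" if "x \<in> D" "y \<in> D" for x y
    using add[of x "(-1) *\<^sub>C y"] scale[of y "-1"] that by simp
  have "uniformly_continuous_on D f"
    unfolding uniformly_continuous_on_def
  proof (intro allI impI)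
    fix e :: real assume "e > 0"
    moreover have "dist (f x) (f y) \<le> dist x y" if "x \<in> D" "y \<in> D" for x y
      using diff[OF that] bound[of "x - y"] by (simp add: dist_norm)
    ultimately show "\<exists>d>0. \<forall>x\<in>D. \<forall>x'\<in>D. dist x' x < d \<longrightarrow> dist (f x') (f x) < e"
      by (intro exI[of _ e]) fastforce
  qed
  then obtain g where g: "uniformly_continuous_on (closure D) g" "\<And>x. x \<in> D \<Longrightarrow> f x = g x"
    using uniformly_continuous_on_extension_on_closure by metis
  have "continuous_on UNIV g" using uniformly_continuous_imp_continuous[OF g(1)] dense by simp
  then have lim: "(\<lambda>n. g (s n)) \<longlonglongrightarrow> g x" if "s \<longlonglongrightarrow> x" for s x
    by (metis UNIV_I continuous_on_tendsto_compose eventually_sequentially that)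
  have seq: "\<exists>s. (\<forall>n. s n \<in> D) \<and> s \<longlonglongrightarrow> x" for x
    using dense by (metis UNIV_I closure_sequential)
  have g_add: "g (x + y) = g x + g y" for x y
  proof -
    obtain s t where st: "\<And>n. s n \<in> D" "s \<longlonglongrightarrow> x" "\<And>n. t n \<in> D" "t \<longlonglongrightarrow> y"
      using seq[of x] seq[of y] by blast
    have "g (s n + t n) = g (s n) + g (t n)" for n using add st(1,3) g(2) by metis
    then have "(\<lambda>n. g (s n + t n)) \<longlonglongrightarrow> g x + g y"
      using tendsto_add[OF lim lim, OF st(2,4)] by simp
    then show ?thesis using lim[OF tendsto_add[OF st(2,4)]] LIMSEQ_unique by blast
  qed
  have g_mult: "g (x * y) = g (y * x)" for x y
  proof -
    obtain s t where st: "\<And>n. s n \<in> D" "s \<longlonglongrightarrow> x" "\<And>n. t n \<in> D" "t \<longlonglongrightarrow> y"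
      using seq[of x] seq[of y] by blast
    have "g (s n * t n) = g (t n * s n)" for n using mult st(1,3) g(2) by metis
    then have "(\<lambda>n. g (s n * t n)) \<longlonglongrightarrow> g (y * x)" using lim[OF tendsto_mult[OF st(4,2)]] by simp
    then show ?thesis using lim[OF tendsto_mult[OF st(2,4)]] LIMSEQ_unique by blast
  qed
  have g_scale: "g (c *\<^sub>C x) = c * g x" for c x
  proof -
    obtain s where s: "\<And>n. s n \<in> D" "s \<longlonglongrightarrow> x" using seq[of x] by blast
    have "g (c *\<^sub>C s n) = c * g (s n)" for n using scale s(1) g(2) by metis
    then have "(\<lambda>n. g (c *\<^sub>C s n)) \<longlonglongrightarrow> c * g x" using tendsto_mult[OF tendsto_const lim[OF s(2)]] by simp
    then show ?thesis using lim[OF tendsto_scaleC[OF tendsto_const s(2)]] LIMSEQ_unique by blast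
  qed
  have g_pos: "0 \<le> g (star x * x)" for x
  proof -
    obtain s where s: "\<And>n. s n \<in> D" "s \<longlonglongrightarrow> x" using seq[of x] by blast
    have "0 \<le> g (star (s n) * s n)" for n using star mult s(1) g(2) by metis
    with lim[OF tendsto_mult[OF tendsto_star[OF s(2)] s(2)]] show ?thesis by (rule nonneg_complex_lim)
  qed
  have g_bound: "cmod (g x) \<le> norm x" for x
  proof -
    obtain s where s: "\<And>n. s n \<in> D" "s \<longlonglongrightarrow> x" using seq[of x] by blast
    have "cmod (g (s n)) \<le> norm (s n)" for n using bound s(1) g(2) by metis
    then show ?thesis
      using LIMSEQ_le[OF tendsto_norm[OF lim[OF s(2)]] tendsto_norm[OF s(2)]] by blast
  qed
  have lin: "bounded_linear g"
    by (rule bounded_linear_intro[of _ 1])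
      (auto simp: g_add g_scale g_bound scaleR_eq_scaleC scaleR_conv_of_real[where 'a = complex])
  \<comment> \<open>Contractivity gives one bound on the norm and the value at the unit gives the
    other.\<close>
  have "onorm g \<le> 1" using g_bound by (intro onorm_bound) auto
  moreover have "1 \<le> onorm g" using onorm[OF lin, of 1] g(2)[OF one(1)] one(2) by simp
  ultimately have "tracial_state g"
    using lin g_scale g_pos g_mult by (simp add: tracial_state_def state_def)
  with g(2) g_bound that show ?thesis by metis
qed

lemma star_one [simp]: "star 1 = (1 :: 'a::unital_cstar_algebra)"
  using star_mult[of "star 1" "1 :: 'a"] by (simp add: star_star)

section \<open>The trace on the union of the matrix algebras\<close>

locale matrix_limit =
  fixes k :: "nat \<Rightarrow> nat" and \<phi> and \<mu> :: "nat \<Rightarrow> complex mat \<Rightarrow> 'a::unital_cstar_algebra"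
  assumes lim: "inductive_limit_of_matrix_algebras k \<phi> \<mu>"

sublocale matrix_limit \<subseteq> matrix_subalgebra "k n" "\<mu> n" for n
  using lim by unfold_locales (auto simp: inductive_limit_of_matrix_algebras_def)

context matrix_limit
begin

definition D :: "'a set" where "D = (\<Union>n. \<mu> n ` M n)"

lemma dense: "closure D = UNIV"
  using lim by (simp add: inductive_limit_of_matrix_algebras_def D_def)

text \<open>In the limit algebra \<open>X\<close> and its image under \<open>\<phi> n\<close>
  coincide, so the commutator decomposition of \<open>X\<close> also describes the image.
  Injectivity of the next embedding makes this an equality of matrices, whose trace is visible; the
  multiplicity of the connecting map is never computed.\<close>

lemma ntrace_connecting:
  assumes X: "X \<in> M n"
  shows "\<phi> n X \<in> M (Suc n) \<and> \<mu> (Suc n) (\<phi> n X) = \<mu> n X \<and> ntrace (k (Suc n)) (\<phi> n X) = ntrace (k n) X"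
proof -
  have emb: "unital_matrix_embedding (k n) (k (Suc n)) (\<phi> n)"
    and compat: "\<And>x. x \<in> M n \<Longrightarrow> \<mu> (Suc n) (\<phi> n x) = \<mu> n x"
    using lim by (auto simp: inductive_limit_of_matrix_algebras_def)
  have \<phi>M: "\<phi> n x \<in> M (Suc n)" if "x \<in> M n" for x
    using emb that by (auto simp: unital_matrix_embedding_def)
  obtain A B C E where M: "A \<in> M n" "B \<in> M n" "C \<in> M n" "E \<in> M n"
    and eq: "\<mu> n X = ntrace (k n) X *\<^sub>C 1 + ((\<mu> n A * \<mu> n B - \<mu> n B * \<mu> n A) + (\<mu> n C * \<mu> n E - \<mu> n E * \<mu> n C))"
    using hom_sum_of_two_commutators[OF X] by blast
  let ?l = "k (Suc n)"
  \<comment> \<open>The decomposition of \<open>X\<close> rebuilt one level higher from the images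
    of the same factors, with the trace of the old level as coefficient.\<close>
  let ?Y = "ntrace (k n) X \<cdot>\<^sub>m 1\<^sub>m ?l
    + (mat_commutator (\<phi> n A) (\<phi> n B) + mat_commutator (\<phi> n C) (\<phi> n E))"
  have mm: "x * y \<in> M (Suc n)" if "x \<in> M (Suc n)" "y \<in> M (Suc n)" for x y
    using that by (rule mult_carrier_mat)
  have c: "mat_commutator (\<phi> n A) (\<phi> n B) \<in> M (Suc n)"
    "mat_commutator (\<phi> n C) (\<phi> n E) \<in> M (Suc n)"
    using M \<phi>M by (simp_all add: mm)
  have "\<mu> (Suc n) ?Y = ntrace (k n) X *\<^sub>C \<mu> (Suc n) (1\<^sub>m ?l)
      + (\<mu> (Suc n) (mat_commutator (\<phi> n A) (\<phi> n B)) + \<mu> (Suc n) (mat_commutator (\<phi> n C) (\<phi> n E)))"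
    using c by (subst hom_add hom_scale; simp)+
  also have "\<dots> = \<mu> (Suc n) (\<phi> n X)"
    using M \<phi>M X by (simp only: hom_commutator hom_one compat eq)
  finally have "\<mu> (Suc n) ?Y = \<mu> (Suc n) (\<phi> n X)" .
  moreover have "?Y \<in> M (Suc n)" using c by simp
  ultimately have "\<phi> n X = ?Y" using hom_inj[of "\<phi> n X" "Suc n" ?Y] \<phi>M[OF X] by simp
  also have "ntrace ?l ?Y = ntrace (k n) X"
    using M \<phi>M c dim[of "Suc n"]
      ntrace_mult_commute[of "\<phi> n A" ?l "\<phi> n B"] ntrace_mult_commute[of "\<phi> n C" ?l "\<phi> n E"]
    by (simp add: ntrace_add ntrace_smult ntrace_one mm)
  finally show ?thesis using \<phi>M compat X by simp
qed

lemma lift_matrix: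
  assumes "m \<le> n" "X \<in> M m"
  shows "\<exists>Y\<in>M n. \<mu> n Y = \<mu> m X \<and> ntrace (k n) Y = ntrace (k m) X"
  using assms
proof (induction n rule: dec_induct)
  case (step n)
  then show ?case using ntrace_connecting by metis
qed auto

definition trace_on :: "'a \<Rightarrow> complex" where
  "trace_on x = (THE t. \<exists>n. \<exists>X\<in>M n. \<mu> n X = x \<and> ntrace (k n) X = t)"

text \<open>The description in \<open>trace_on\<close> is unambiguous: two representatives lift to a
  common level with their traces unchanged, and there injectivity makes them equal.\<close>

lemma trace_on: "X \<in> M n \<Longrightarrow> trace_on (\<mu> n X) = ntrace (k n) X"
  unfolding trace_on_def
proof (rule the_equality)
  fix t assume X: "X \<in> M n" and "\<exists>m. \<exists>Y\<in>M m. \<mu> m Y = \<mu> n X \<and> ntrace (k m) Y = t"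
  then obtain m Y where Y: "Y \<in> M m" "\<mu> m Y = \<mu> n X" "ntrace (k m) Y = t" by blast
  obtain X' where X': "X' \<in> M (max m n)" "\<mu> (max m n) X' = \<mu> n X"
    "ntrace (k (max m n)) X' = ntrace (k n) X"
    using lift_matrix[OF max.cobounded2 X] by blast
  obtain Y' where Y': "Y' \<in> M (max m n)" "\<mu> (max m n) Y' = \<mu> m Y"
    "ntrace (k (max m n)) Y' = ntrace (k m) Y"
    using lift_matrix[OF max.cobounded1 Y(1)] by blast
  have "X' = Y'" using X' Y' Y(2) by (intro hom_inj[where n = "max m n"]) auto
  then show "t = ntrace (k n) X" using X'(3) Y'(3) Y(3) by simp
qed blast

lemma common_level:
  assumes "x \<in> D" "y \<in> D"
  obtains n X Y where "X \<in> M n" "Y \<in> M n" "x = \<mu> n X" "y = \<mu> n Y"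
proof -
  obtain m n X Y where *: "X \<in> M m" "x = \<mu> m X" "Y \<in> M n" "y = \<mu> n Y"
    using assms unfolding D_def by blast
  obtain X' where "X' \<in> M (max m n)" "\<mu> (max m n) X' = \<mu> m X"
    using lift_matrix[OF max.cobounded1 *(1)] by blast
  moreover obtain Y' where "Y' \<in> M (max m n)" "\<mu> (max m n) Y' = \<mu> n Y"
    using lift_matrix[OF max.cobounded2 *(3)] by blast
  ultimately show ?thesis using that * by metis
qed

lemma mem_D: "X \<in> M n \<Longrightarrow> \<mu> n X \<in> D"
  unfolding D_def by blast

lemma tracial_state_exists:
  obtains \<tau> where "tracial_state \<tau>" "\<And>n X. X \<in> M n \<Longrightarrow> \<tau> (\<mu> n X) = ntrace (k n) X"
    "\<And>x. cmod (\<tau> x) \<le> norm x"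
proof (rule tracial_state_extension[OF dense, of trace_on])
  have mm: "x * y \<in> M n" if "x \<in> M n" "y \<in> M n" for x y n
    using that by (rule mult_carrier_mat)
  fix x y assume "x \<in> D" "y \<in> D"
  then obtain n X Y where X: "X \<in> M n" "x = \<mu> n X" and Y: "Y \<in> M n" "y = \<mu> n Y"
    using common_level by metis
  have "X + Y \<in> M n" using X Y by simp
  then show "x + y \<in> D \<and> trace_on (x + y) = trace_on x + trace_on y"
    using mem_D[of "X + Y" n] trace_on[of "X + Y" n] X Y by (simp add: hom_add trace_on ntrace_add)
  show "x * y \<in> D \<and> trace_on (x * y) = trace_on (y * x)"
    using mem_D[OF mm, of X n Y] trace_on[OF mm, of X n Y] trace_on[OF mm, of Y n X] X Y
    by (simp add: hom_mult ntrace_mult_commute)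
next
  fix c x assume "x \<in> D"
  then obtain n X where X: "X \<in> M n" "x = \<mu> n X" unfolding D_def by blast
  then show "c *\<^sub>C x \<in> D \<and> trace_on (c *\<^sub>C x) = c * trace_on x"
    using mem_D[of "c \<cdot>\<^sub>m X" n] trace_on[of "c \<cdot>\<^sub>m X" n] by (simp add: hom_scale trace_on ntrace_smult)
next
  fix x assume "x \<in> D"
  then obtain n X where X: "X \<in> M n" "x = \<mu> n X" unfolding D_def by blast
  have X': "mat_adjoint X \<in> M n" by (rule mat_adjoint_carrier[OF X(1)])
  show "star x \<in> D \<and> 0 \<le> trace_on (star x * x)"
    using mem_D[OF X'] trace_on[OF mult_carrier_mat[OF X' X(1)]] ntrace_adjoint_mult_nonneg[OF X(1)]
      X X' by (simp add: hom_star hom_mult)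
  show "cmod (trace_on x) \<le> norm x" using X ntrace_le_norm trace_on by simp
next
  show "1 \<in> D" "trace_on 1 = 1"
    using mem_D[of "1\<^sub>m (k 0)" 0] trace_on[of "1\<^sub>m (k 0)" 0] dim[of 0] by (simp_all add: hom_one ntrace_one)
next
  fix \<tau> assume "tracial_state \<tau>" "\<And>x. x \<in> D \<Longrightarrow> \<tau> x = trace_on x" "\<And>x. cmod (\<tau> x) \<le> norm x"
  then show ?thesis using that mem_D trace_on by metis
qed

text \<open>A trace annihilates the commutators. The factor \<open>\<sigma> 1\<close> stays for now,
  since states are normalized by their norm and not by their value at the unit.\<close>

lemma tracial_state_on_matrices:
  assumes \<sigma>: "tracial_state \<sigma>" and X: "X \<in> M n"
  shows "\<sigma> (\<mu> n X) = ntrace (k n) X * \<sigma> 1"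
proof -
  have lin: "bounded_linear \<sigma>" and homog: "\<And>c x. \<sigma> (c *\<^sub>C x) = c * \<sigma> x"
    and tr: "\<And>x y. \<sigma> (x * y) = \<sigma> (y * x)"
    using \<sigma> by (auto simp: tracial_state_def state_def)
  interpret bounded_linear \<sigma> by (rule lin)
  obtain A B C E where "\<mu> n X = ntrace (k n) X *\<^sub>C 1
      + ((\<mu> n A * \<mu> n B - \<mu> n B * \<mu> n A) + (\<mu> n C * \<mu> n E - \<mu> n E * \<mu> n C))"
    using hom_sum_of_two_commutators[OF X] by metis
  then show ?thesis
    using tr[of "\<mu> n A" "\<mu> n B"] tr[of "\<mu> n C" "\<mu> n E"] by (simp add: add diff homog)
qed

text \<open>By continuity \<open>\<sigma>\<close> is \<open>\<sigma> 1\<close> times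
  \<open>\<tau>\<close> everywhere. Norm one and contractivity of \<open>\<tau>\<close> force
  \<open>\<sigma> 1\<close> to have modulus one; positivity then makes it 1.\<close>

lemma tracial_state_unique:
  assumes \<sigma>: "tracial_state \<sigma>" and \<tau>: "tracial_state \<tau>"
    and \<tau>_mat: "\<And>n X. X \<in> M n \<Longrightarrow> \<tau> (\<mu> n X) = ntrace (k n) X"
    and \<tau>_bound: "\<And>x. cmod (\<tau> x) \<le> norm x"
  shows "\<sigma> = \<tau>"
proof -
  have lin: "bounded_linear \<sigma>" "bounded_linear \<tau>" and norm: "onorm \<sigma> = 1"
    and pos: "0 \<le> \<sigma> (star 1 * 1)"
    using \<sigma> \<tau> unfolding tracial_state_def state_def by blast+
  have "closed {x. \<sigma> x = \<tau> x * \<sigma> 1}"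
    using lin by (intro closed_Collect_eq continuous_intros linear_continuous_on) auto
  moreover have "D \<subseteq> {x. \<sigma> x = \<tau> x * \<sigma> 1}"
    using tracial_state_on_matrices[OF \<sigma>] \<tau>_mat by (auto simp: D_def)
  ultimately have "closure D \<subseteq> {x. \<sigma> x = \<tau> x * \<sigma> 1}" by (rule closure_minimal[rotated])
  then have eq: "\<sigma> x = \<tau> x * \<sigma> 1" for x using dense by auto
  have "cmod (\<sigma> x) \<le> cmod (\<sigma> 1) * norm x" for x
    using mult_right_mono[OF \<tau>_bound[of x], of "cmod (\<sigma> 1)"] by (subst eq) (simp add: norm_mult mult.commute)
  then have "1 \<le> cmod (\<sigma> 1)" using onorm_bound[of "cmod (\<sigma> 1)" \<sigma>] norm by simp
  moreover have "cmod (\<sigma> 1) \<le> 1" using onorm[OF lin(1), of 1] norm by simp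
  ultimately have "cmod (\<sigma> 1) = 1" by simp
  moreover have "Im (\<sigma> 1) = 0" "0 \<le> Re (\<sigma> 1)" using pos by (simp_all add: less_eq_complex_def)
  ultimately have "\<sigma> 1 = 1" by (simp add: cmod_eq_Re complex_eq_iff)
  then show ?thesis using eq by (metis ext mult.right_neutral)
qed

lemma dense_sum_of_two_commutators:
  assumes "e > 0"
  obtains t and x\<^sub>1 y\<^sub>1 x\<^sub>2 y\<^sub>2 :: 'a where
    "norm (q + ((x\<^sub>1 * y\<^sub>1 - y\<^sub>1 * x\<^sub>1) + (x\<^sub>2 * y\<^sub>2 - y\<^sub>2 * x\<^sub>2)) - t *\<^sub>C 1) < e"
proof -
  obtain x where "x \<in> D" and x: "dist x q < e"
    using dense assms by (metis UNIV_I closure_approachable)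
  then obtain n X where X: "X \<in> M n" "x = \<mu> n X" unfolding D_def by blast
  obtain A B C E where "\<mu> n X = ntrace (k n) X *\<^sub>C 1
      + ((\<mu> n A * \<mu> n B - \<mu> n B * \<mu> n A) + (\<mu> n C * \<mu> n E - \<mu> n E * \<mu> n C))"
    using hom_sum_of_two_commutators[OF X(1)] by metis
  \<comment> \<open>Exchanging the two factors negates a commutator, so those of \<open>x\<close>
    move to the side of \<open>q\<close> and only \<open>q - x\<close> remains.\<close>
  then have "q + ((\<mu> n B * \<mu> n A - \<mu> n A * \<mu> n B) + (\<mu> n E * \<mu> n C - \<mu> n C * \<mu> n E))
      - ntrace (k n) X *\<^sub>C 1 = q - x"
    using X by simp
  then show ?thesis using x that by (metis dist_commute dist_norm)
qed

end

subsection \<open>Density of the rational points\<close>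

lemma complex_of_gaussian_dense: "closure (range complex_of_gaussian) = UNIV"
proof -
  have "c \<in> closure (range complex_of_gaussian)" for c
    unfolding closure_approachable
  proof (intro allI impI)
    fix e :: real assume e: "e > 0"
    obtain p where p: "Re c < of_rat p" "of_rat p < Re c + e / 2"
      using of_rat_dense[of "Re c" "Re c + e / 2"] e by auto
    obtain q where q: "Im c < of_rat q" "of_rat q < Im c + e / 2"
      using of_rat_dense[of "Im c" "Im c + e / 2"] e by auto
    have "dist (complex_of_gaussian (p, q)) c < e"
      using cmod_le[of "complex_of_gaussian (p, q) - c"] p q
      by (simp add: dist_norm complex_of_gaussian_def)
    then show "\<exists>y\<in>range complex_of_gaussian. dist y c < e" by blast
  qed
  then show ?thesis by blast
qed

lemma range_rational_point: "range (rational_point a) = range (eval_poly a)"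
proof -
  have "rational_point a = eval_poly a \<circ> poly_decode" by (auto simp: rational_point_def)
  then show ?thesis by (metis image_comp surj_poly_decode)
qed

text \<open>Induction on the generated algebra: the closure of the rational points is stable under
  its operations, by approximating the arguments. Arbitrary complex scalars are reached through the
  density of the Gaussian rationals.\<close>

lemma rational_points_dense:
  fixes a :: "nat \<Rightarrow> 'a::unital_cstar_algebra"
  assumes "presentation a"
  shows "closure (range (rational_point a)) = UNIV"
proof -
  let ?P = "range (eval_poly a)"
  have seq: "\<exists>s. (\<forall>n. s n \<in> ?P) \<and> s \<longlonglongrightarrow> x" if "x \<in> closure ?P" for x
    using that by (simp only: closure_sequential)
  have "x \<in> closure ?P" if "x \<in> generated_star_subalgebra (range a)" for x
    using that
  proof induction
    case (gen x)
    then obtain i where "x = eval_poly a (Indet i)" by auto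
    then have "x \<in> ?P" by (rule range_eqI)
    then show ?case by (rule subsetD[OF closure_subset])
  next
    case zero
    \<comment> \<open>There are no constants, so zero is obtained by scaling an indeterminate by
      zero.\<close>
    have "eval_poly a (Scale (0, 0) (Indet 0)) = 0"
      using bounded_bilinear.zero_left[OF bounded_bilinear_scaleC]
      by (simp add: complex_of_gaussian_def Complex_eq)
    then have "0 \<in> ?P" by (rule range_eqI[OF sym])
    then show ?case by (rule subsetD[OF closure_subset])
  next
    case (add x y)
    then obtain s t where st: "\<And>n. s n \<in> ?P" "s \<longlonglongrightarrow> x" "\<And>n. t n \<in> ?P" "t \<longlonglongrightarrow> y"
      using seq[of x] seq[of y] by blast
    have "u + v \<in> ?P" if "u \<in> ?P" "v \<in> ?P" for u v
      using that by (auto simp flip: eval_poly.simps(3))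
    then show ?case unfolding closure_sequential
      using tendsto_add[OF st(2,4)] st(1,3) by (intro exI[of _ "\<lambda>n. s n + t n"]) auto
  next
    case (scale x c)
    then obtain s where s: "\<And>n. s n \<in> ?P" "s \<longlonglongrightarrow> x" using seq[of x] by blast
    have "c \<in> closure (range complex_of_gaussian)" using complex_of_gaussian_dense by simp
    then obtain r where r: "\<And>n. r n \<in> range complex_of_gaussian" "r \<longlonglongrightarrow> c"
      unfolding closure_sequential by blast
    have "u *\<^sub>C v \<in> ?P" if "u \<in> range complex_of_gaussian" "v \<in> ?P" for u v
      using that by (auto simp flip: eval_poly.simps(2))
    then show ?case unfolding closure_sequential
      using tendsto_scaleC[OF r(2) s(2)] r(1) s(1) by (intro exI[of _ "\<lambda>n. r n *\<^sub>C s n"]) auto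
  next
    case (mult x y)
    then obtain s t where st: "\<And>n. s n \<in> ?P" "s \<longlonglongrightarrow> x" "\<And>n. t n \<in> ?P" "t \<longlonglongrightarrow> y"
      using seq[of x] seq[of y] by blast
    have "u * v \<in> ?P" if "u \<in> ?P" "v \<in> ?P" for u v
      using that by (auto simp flip: eval_poly.simps(4))
    then show ?case unfolding closure_sequential
      using tendsto_mult[OF st(2,4)] st(1,3) by (intro exI[of _ "\<lambda>n. s n * t n"]) auto
  next
    case (star x)
    then obtain s where s: "\<And>n. s n \<in> ?P" "s \<longlonglongrightarrow> x" using seq[of x] by blast
    have "star u \<in> ?P" if "u \<in> ?P" for u
      using that by (auto simp flip: eval_poly.simps(5))
    then show ?case unfolding closure_sequential
      using tendsto_star[OF s(2)] s(1) by (intro exI[of _ "\<lambda>n. star (s n)"]) auto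
  qed
  then have "closure (generated_star_subalgebra (range a)) \<subseteq> closure ?P"
    by (intro closure_minimal) auto
  then show ?thesis using assms by (auto simp: presentation_def range_rational_point)
qed

subsection \<open>The search for a certificate\<close>

text \<open>The remainders 1, 2 and 3 modulo 5 in this and the next two definitions are the
  constructor tags read by \<open>poly_decode\<close>.\<close>

definition scale_code :: "nat \<Rightarrow> nat \<Rightarrow> nat" where
  "scale_code c i = 5 * prod_encode (c, i) + 1"

definition plus_code :: "nat \<Rightarrow> nat \<Rightarrow> nat" where
  "plus_code i j = 5 * prod_encode (i, j) + 2"

definition times_code :: "nat \<Rightarrow> nat \<Rightarrow> nat" where
  "times_code i j = 5 * prod_encode (i, j) + 3"

text \<open>Any code of -1 will do: it enters the algorithm as a constant, so choosing it needs no
  computation.\<close>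

definition minus_one_code :: nat where
  "minus_one_code = (SOME c. gaussian_decode c = (- 1, 0))"

definition commutator_code :: "nat \<Rightarrow> nat \<Rightarrow> nat" where
  "commutator_code i j = plus_code (times_code i j) (scale_code minus_one_code (times_code j i))"

lemma rational_point_scale_code:
  "rational_point a (scale_code c i) = complex_of_gaussian (gaussian_decode c) *\<^sub>C rational_point a i"
  by (simp only: rational_point_def scale_code_def poly_decode_code eval_poly.simps)

lemma rational_point_plus_code:
  "rational_point a (plus_code i j) = rational_point a i + rational_point a j"
  by (simp only: rational_point_def plus_code_def poly_decode_code eval_poly.simps)

lemma rational_point_times_code:
  "rational_point a (times_code i j) = rational_point a i * rational_point a j"
  by (simp only: rational_point_def times_code_def poly_decode_code eval_poly.simps)

lemma complex_of_minus_one_code: "complex_of_gaussian (gaussian_decode minus_one_code) = - 1"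
proof -
  have "gaussian_decode minus_one_code = (- 1, 0)"
    unfolding minus_one_code_def using surj_gaussian_decode by (metis (mono_tags, lifting) someI surj_def)
  then show ?thesis by (simp add: complex_of_gaussian_def complex_eq_iff)
qed

lemma rational_point_commutator_code:
  "rational_point a (commutator_code i j) =
    rational_point a i * rational_point a j - rational_point a j * rational_point a i"
  by (simp add: commutator_code_def rational_point_scale_code rational_point_plus_code
      rational_point_times_code complex_of_minus_one_code)

text \<open>For \<open>m\<close> encoding \<open>(z, x\<^sub>1, y\<^sub>1, x\<^sub>2, y\<^sub>2)\<close>, a code of \<open>(q\<^sub>n + [x\<^sub>1, y\<^sub>1] + [x\<^sub>2, y\<^sub>2]) e - z e\<close>,
  where \<open>e\<close> has code \<open>u\<close>.\<close>

definition residual_code :: "nat \<Rightarrow> nat \<Rightarrow> nat \<Rightarrow> nat" where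
  "residual_code u m n =
    (let z = fst (prod_decode m); m\<^sub>1 = snd (prod_decode m);
         p = fst (prod_decode m\<^sub>1); r = snd (prod_decode m\<^sub>1) in
     plus_code
       (times_code
         (plus_code n
           (plus_code
             (commutator_code (fst (prod_decode p)) (snd (prod_decode p)))
             (commutator_code (fst (prod_decode r)) (snd (prod_decode r)))))
         u)
       (scale_code minus_one_code (scale_code z u)))"

text \<open>Only arithmetic on codes occurs, and \<open>u\<close> is a constant: its existence
  suffices, it need not be found effectively.\<close>

lemma computable_on_residual_code:
  assumes "computable_on l X" "computable_on l Y"
  shows "computable_on l (\<lambda>xs. residual_code u (X xs) (Y xs))"
  unfolding residual_code_def Let_def commutator_code_def scale_code_def plus_code_def times_code_def
  by (intro computable_on_intros assms)

lemma rational_point_residual_code: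
  fixes a :: "nat \<Rightarrow> 'a::unital_cstar_algebra"
  defines "comm \<equiv> \<lambda>i j. rational_point a i * rational_point a j - rational_point a j * rational_point a i"
  shows "rational_point a (residual_code u
      (prod_encode (z, prod_encode (prod_encode (i, j), prod_encode (i', j')))) n) =
    (rational_point a n + (comm i j + comm i' j')
      - complex_of_gaussian (gaussian_decode z) *\<^sub>C 1) * rational_point a u"
  by (simp add: residual_code_def comm_def rational_point_plus_code rational_point_times_code
      rational_point_commutator_code rational_point_scale_code complex_of_minus_one_code
      left_diff_distrib mult_scaleC_left)

text \<open>Soundness of a certificate. The trace maps \<open>v\<close> to
  \<open>\<tau> q - z\<close>, so it suffices to bound \<open>norm v\<close>. Splitting
  \<open>v\<close> as \<open>v * e - v * (e - 1)\<close> costs at most half of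
  \<open>norm v\<close>, whence \<open>norm v <= 2 * norm (v * e)\<close>.\<close>

lemma trace_le_residual:
  assumes \<tau>: "tracial_state \<tau>" "\<tau> 1 = 1" "\<And>x. cmod (\<tau> x) \<le> norm x"
    and e: "norm (e - 1) \<le> 1 / 2"
  shows "cmod (\<tau> q - z) \<le>
    2 * norm ((q + ((x\<^sub>1 * y\<^sub>1 - y\<^sub>1 * x\<^sub>1) + (x\<^sub>2 * y\<^sub>2 - y\<^sub>2 * x\<^sub>2)) - z *\<^sub>C 1) * e)"
proof -
  have lin: "bounded_linear \<tau>" and homog: "\<And>c x. \<tau> (c *\<^sub>C x) = c * \<tau> x"
    and tr: "\<And>x y. \<tau> (x * y) = \<tau> (y * x)"
    using \<tau>(1) by (auto simp: tracial_state_def state_def)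
  interpret bounded_linear \<tau> by (rule lin)
  define v where "v = q + ((x\<^sub>1 * y\<^sub>1 - y\<^sub>1 * x\<^sub>1) + (x\<^sub>2 * y\<^sub>2 - y\<^sub>2 * x\<^sub>2)) - z *\<^sub>C 1"
  have "\<tau> v = \<tau> q - z"
    using tr[of x\<^sub>1 y\<^sub>1] tr[of x\<^sub>2 y\<^sub>2] by (simp add: v_def add diff homog \<tau>(2))
  moreover have "norm v \<le> norm (v * e) + norm (v * (e - 1))"
    using norm_triangle_ineq4[of "v * e" "v * (e - 1)"] by (simp add: algebra_simps)
  moreover have "norm (v * (e - 1)) \<le> norm v * (1 / 2)"
    using mult_left_mono[OF e norm_ge_zero[of v]] norm_mult_ineq[of v "e - 1"] by linarith
  ultimately show ?thesis using \<tau>(3)[of v] by (simp add: v_def)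
qed

context matrix_limit
begin

text \<open>Termination of the search. Arbitrary elements and a complex scalar with small residual
  exist by density of the commutator sums; the residual is continuous in all five, so rational ones
  can replace them.\<close>

lemma small_residual_exists:
  fixes a :: "nat \<Rightarrow> 'a"
  assumes "presentation a" "\<delta> > 0"
  shows "\<exists>m. norm (rational_point a (residual_code u m n)) < \<delta>"
proof -
  let ?e = "rational_point a u" and ?q = "rational_point a n"
  let ?w = "\<lambda>x\<^sub>1 y\<^sub>1 x\<^sub>2 y\<^sub>2 :: 'a. (x\<^sub>1 * y\<^sub>1 - y\<^sub>1 * x\<^sub>1) + (x\<^sub>2 * y\<^sub>2 - y\<^sub>2 * x\<^sub>2)"
  let ?R = "\<lambda>t x\<^sub>1 y\<^sub>1 x\<^sub>2 y\<^sub>2. norm ((?q + ?w x\<^sub>1 y\<^sub>1 x\<^sub>2 y\<^sub>2 - t *\<^sub>C 1) * ?e)"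
  \<comment> \<open>Dividing by \<open>norm ?e + 1\<close> absorbs the later multiplication by
    \<open>?e\<close> and avoids a zero denominator.\<close>
  have "\<delta> / (norm ?e + 1) > 0" using assms(2) by (simp add: add_nonneg_pos)
  from dense_sum_of_two_commutators[OF this, of ?q] obtain t x\<^sub>1 y\<^sub>1 x\<^sub>2 y\<^sub>2 where
    small: "norm (?q + ?w x\<^sub>1 y\<^sub>1 x\<^sub>2 y\<^sub>2 - t *\<^sub>C 1) < \<delta> / (norm ?e + 1)"
    by metis
  have "?R t x\<^sub>1 y\<^sub>1 x\<^sub>2 y\<^sub>2 \<le> norm (?q + ?w x\<^sub>1 y\<^sub>1 x\<^sub>2 y\<^sub>2 - t *\<^sub>C 1) * (norm ?e + 1)"
    using norm_mult_ineq by (smt (verit) mult_left_mono norm_ge_zero)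
  also have "\<dots> < \<delta>"
    using small by (simp add: pos_less_divide_eq add_nonneg_pos)
  finally have R: "?R t x\<^sub>1 y\<^sub>1 x\<^sub>2 y\<^sub>2 < \<delta>" .
  have seq: "\<exists>s. (\<lambda>i. rational_point a (s i)) \<longlonglongrightarrow> x" for x
  proof -
    have "x \<in> closure (range (rational_point a))" using rational_points_dense[OF assms(1)] by simp
    then obtain r where r: "\<And>i. r i \<in> range (rational_point a)" "r \<longlonglongrightarrow> x"
      unfolding closure_sequential by blast
    then have "\<forall>i. \<exists>c. r i = rational_point a c" by blast
    from choice[OF this] obtain s where "\<forall>i. r i = rational_point a (s i)" by blast
    then have "r = (\<lambda>i. rational_point a (s i))" by auto
    with r(2) show ?thesis by blast
  qed
  obtain sx\<^sub>1 sy\<^sub>1 sx\<^sub>2 sy\<^sub>2 where s: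
    "(\<lambda>i. rational_point a (sx\<^sub>1 i)) \<longlonglongrightarrow> x\<^sub>1" "(\<lambda>i. rational_point a (sy\<^sub>1 i)) \<longlonglongrightarrow> y\<^sub>1"
    "(\<lambda>i. rational_point a (sx\<^sub>2 i)) \<longlonglongrightarrow> x\<^sub>2" "(\<lambda>i. rational_point a (sy\<^sub>2 i)) \<longlonglongrightarrow> y\<^sub>2"
    using seq[of x\<^sub>1] seq[of y\<^sub>1] seq[of x\<^sub>2] seq[of y\<^sub>2] by blast
  have "t \<in> closure (range complex_of_gaussian)" using complex_of_gaussian_dense by simp
  then obtain r where r: "\<And>i. r i \<in> range complex_of_gaussian" "r \<longlonglongrightarrow> t"
    unfolding closure_sequential by blast
  have "\<exists>c. r i = complex_of_gaussian (gaussian_decode c)" for i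
    using r(1)[of i] surj_gaussian_decode by (metis imageE surj_def)
  then obtain st where st: "\<And>i. r i = complex_of_gaussian (gaussian_decode (st i))" by metis
  have "(\<lambda>i. ?R (r i) (rational_point a (sx\<^sub>1 i)) (rational_point a (sy\<^sub>1 i))
      (rational_point a (sx\<^sub>2 i)) (rational_point a (sy\<^sub>2 i))) \<longlonglongrightarrow> ?R t x\<^sub>1 y\<^sub>1 x\<^sub>2 y\<^sub>2"
    by (intro tendsto_intros tendsto_scaleC s r)
  from order_tendstoD(2)[OF this R] obtain i where
    "?R (r i) (rational_point a (sx\<^sub>1 i)) (rational_point a (sy\<^sub>1 i))
      (rational_point a (sx\<^sub>2 i)) (rational_point a (sy\<^sub>2 i)) < \<delta>"
    by (auto simp: eventually_sequentially)
  then show ?thesis unfolding st rational_point_residual_code[symmetric] by blast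
qed

lemma tracial_state_computable:
  fixes a :: "nat \<Rightarrow> 'a"
  assumes a: "computable_presentation a"
    and \<tau>: "tracial_state \<tau>" "\<tau> 1 = 1" "\<And>x. cmod (\<tau> x) \<le> norm x"
  shows "computable_functional a \<tau>"
proof -
  have pres: "presentation a" using a by (simp add: computable_presentation_def)
  obtain f where f: "recursive_fun 2 f"
    and f_approx: "\<And>n k. \<bar>norm (rational_point a n) - of_rat (rat_decode (f [n, k]))\<bar> < (1 / 2) ^ k"
    using a by (auto simp: computable_presentation_def)
  have "1 \<in> closure (range (rational_point a))" using rational_points_dense[OF pres] by simp
  then have "\<forall>e>0. \<exists>u. norm (rational_point a u - 1) < e"
    unfolding closure_approachable dist_norm by blast
  from this[rule_format, of "1 / 2"] obtain u where u: "norm (rational_point a u - 1) < 1 / 2"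
    by auto
  \<comment> \<open>The norm is computed to within \<open>(1 / 2) ^ (j + 3)\<close> and the result
    compared with \<open>(1 / 2) ^ (j + 2)\<close>, a decidable comparison of rationals.\<close>
  define T where "T xs = below_pow2 (f [residual_code u (xs ! 0) (xs ! 1), xs ! 2 + 3]) (xs ! 2 + 2)" for xs
  have T_iff: "T [m, n, j] = 0 \<longleftrightarrow>
      of_rat (rat_decode (f [residual_code u m n, j + 3])) < (1 / 2 :: real) ^ (j + 2)" for m n j
  proof -
    have "(1 / 2 :: real) ^ (j + 2) = of_rat ((1 / 2) ^ (j + 2))"
      by (simp add: of_rat_power of_rat_divide)
    moreover have "T [m, n, j] = below_pow2 (f [residual_code u m n, j + 3]) (j + 2)"
      by (simp add: T_def)
    ultimately show ?thesis by (simp only: of_rat_less below_pow2_iff)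
  qed
  have T_zero: "\<exists>m. T [m, n, j] = 0" for n j
  proof -
    \<comment> \<open>A residual below \<open>(1 / 2) ^ (j + 3)\<close> passes the test despite the
      error, since the two bounds add up to the threshold.\<close>
    obtain m where "norm (rational_point a (residual_code u m n)) < (1 / 2) ^ (j + 3)"
      using small_residual_exists[OF pres, of "(1 / 2) ^ (j + 3)" u n] by auto
    moreover have "(1 / 2 :: real) ^ (j + 2) = (1 / 2) ^ (j + 3) + (1 / 2) ^ (j + 3)"
      by (simp add: power_add power2_eq_square power3_eq_cube)
    ultimately show ?thesis
      unfolding T_iff using f_approx[of "residual_code u m n" "j + 3"] by (intro exI[of _ m]) linarith
  qed
  define G where "G xs = fst (prod_decode (LEAST m. T (m # xs) = 0))" for xs
  have "computable_on 2 G"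
    unfolding G_def
  proof (intro computable_on_fst_prod_decode computable_on_Least)
    show "computable_on (2 + 1) T"
      unfolding T_def
      by (intro computable_on_below_pow2 computable_on_comp2[OF recursive_imp_computable_on[OF f]]
          computable_on_residual_code computable_on_intros) auto
    show "\<exists>m. T (m # xs) = 0" if "length xs = 2" for xs
      using T_zero that by (auto simp: numeral_2_eq_2 length_Suc_conv)
  qed
  then obtain g where g: "recursive_fun 2 g" "\<And>n j. g [n, j] = G [n, j]"
    unfolding computable_on_def by (metis One_nat_def Suc_1 length_Cons list.size(3))
  have "cmod (\<tau> (rational_point a n) - complex_of_gaussian (gaussian_decode (g [n, j]))) < (1 / 2) ^ j" for n j
  proof -
    define m where "m = (LEAST m. T [m, n, j] = 0)"
    have "T [m, n, j] = 0" unfolding m_def using T_zero by (rule LeastI_ex)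
    \<comment> \<open>Conversely, an accepted residual is below 3/8 of \<open>(1 / 2) ^ j\<close>,
      hence below one half of it, which leaves room for the factor 2 of
      \<open>trace_le_residual\<close>.\<close>
    then have "norm (rational_point a (residual_code u m n)) < (1 / 2) ^ (j + 2) + (1 / 2) ^ (j + 3)"
      using f_approx[of "residual_code u m n" "j + 3"] unfolding T_iff by linarith
    also have "\<dots> \<le> (1 / 2) ^ j / 2"
      by (simp add: power_add power2_eq_square power3_eq_cube)
    finally have "2 * norm (rational_point a (residual_code u m n)) < (1 / 2) ^ j" by simp
    \<comment> \<open>Pairing is surjective, so whatever number the search finds encodes a scalar
      and four rational points.\<close>
    moreover obtain z i\<^sub>1 j\<^sub>1 i\<^sub>2 j\<^sub>2 where
      m: "m = prod_encode (z, prod_encode (prod_encode (i\<^sub>1, j\<^sub>1), prod_encode (i\<^sub>2, j\<^sub>2)))"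
      by (metis prod_decode_inverse surj_pair)
    moreover have "g [n, j] = z" by (simp add: g(2) G_def m flip: m_def)
    ultimately show ?thesis
      using trace_le_residual[OF \<tau> less_imp_le[OF u], of "rational_point a n"
          "complex_of_gaussian (gaussian_decode z)"]
      unfolding m rational_point_residual_code by (metis le_less_trans)
  qed
  with g(1) \<tau>(1) show ?thesis
    by (auto simp: computable_functional_def tracial_state_def state_def)
qed

end

theorem theorem4p11:
  fixes a :: "nat \<Rightarrow> 'a::unital_cstar_algebra"
  assumes "uhf_algebra TYPE('a)"
    and "computable_presentation a"
  shows "(\<exists>!\<tau> :: 'a \<Rightarrow> complex. tracial_state \<tau>) \<and>
    computable_functional a (the_tracial_state :: 'a \<Rightarrow> complex)"
proof -
  obtain k \<phi> and \<mu> :: "nat \<Rightarrow> complex mat \<Rightarrow> 'a" where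
    "inductive_limit_of_matrix_algebras k \<phi> \<mu>"
    using assms(1) unfolding uhf_algebra_def by blast
  then interpret matrix_limit k \<phi> \<mu> by unfold_locales
  obtain \<tau> :: "'a \<Rightarrow> complex" where \<tau>: "tracial_state \<tau>"
    "\<And>n X. X \<in> M n \<Longrightarrow> \<tau> (\<mu> n X) = ntrace (k n) X" "\<And>x. cmod (\<tau> x) \<le> norm x"
    using tracial_state_exists by blast
  have unique: "\<sigma> = \<tau>" if "tracial_state \<sigma>" for \<sigma>
    using tracial_state_unique[OF that \<tau>] .
  have "\<tau> 1 = 1"
    using \<tau>(2)[of "1\<^sub>m (k 0)" 0] dim[of 0] by (simp add: hom_one ntrace_one)
  then have "computable_functional a \<tau>"
    using tracial_state_computable[OF assms(2) \<tau>(1) _ \<tau>(3)] by blast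
  moreover have "the_tracial_state = \<tau>"
    unfolding the_tracial_state_def using \<tau>(1) unique by (rule the_equality)
  ultimately show ?thesis using \<tau>(1) unique by blast
qed

end
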